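(* Let $\mathcal G$ be a finite, connected, simple bipartite graph with $N_{\mathcal V}$ vertices, each edge identified with $[0,1]$, and let $\mathcal L$ be the self-adjoint operator on $L^2(\mathcal G)$ described in the context. Then the eigenvalues $\lambda$ of $\mathcal L$ satisfy: (i) there are precisely $N_{\mathcal V}-2$ eigenvalues with $0<\lambda<\pi^2$, counted with multiplicity; (ii) there are precisely $N_{\mathcal V}-2$ eigenvalues with $\pi^2<\lambda<(2\pi)^2$, counted with multiplicity, and these have the form $\lambda=(2\pi-\sqrt{\mu})^2$ for $\mu$ an eigenvalue of $\mathcal L$ with $0<\mu<\pi^2$; moreover $\lambda$ and $\mu$ have the same multiplicity.
   Context: $L^2(\mathcal G)=\bigoplus_{e}L^2(e)$ with each $L^2(e)=L^2[0,1]$. The operator $\mathcal L$ acts by $-d^2/dx^2$ on each edge, with domain consisting of $f\in L^2(\mathcal G)$ that are continuous on $\mathcal G$, continuously differentiable on each edge with $f_e'$ absolutely continuous and $f''\in L^2(\mathcal G)$, and satisfying at every vertex $v$ the condition $\sum_{e\sim v}\partial_\nu f_e(v)=0$, where the sum is over edges incident on $v$ and $\partial_\nu$ is the outward derivative in the local coordinate identifying $e$ with $[0,1]$ and $v$ with $0$. *)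

theory Defs
  imports "HOL-Analysis.Analysis" "HOL-Library.Function_Algebras"
begin

text \<open>A finite simple graph is given by a finite vertex set V and a set D of
  oriented edges: (u,w) in D is an edge identified with [0,1], with u at 0 and w at 1.
  Simplicity: no loops and each unordered pair carries at most one edge.\<close>

definition simple_oriented_graph :: "'v set \<Rightarrow> ('v \<times> 'v) set \<Rightarrow> bool" where
  "simple_oriented_graph V D \<longleftrightarrow> finite V \<and> D \<subseteq> V \<times> V \<and>
     (\<forall>u w. (u, w) \<in> D \<longrightarrow> u \<noteq> w \<and> (w, u) \<notin> D)"

definition adj :: "('v \<times> 'v) set \<Rightarrow> 'v \<Rightarrow> 'v \<Rightarrow> bool" where
  "adj D u w \<longleftrightarrow> (u, w) \<in> D \<or> (w, u) \<in> D"

definition graph_connected :: "'v set \<Rightarrow> ('v \<times> 'v) set \<Rightarrow> bool" where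
  "graph_connected V D \<longleftrightarrow> (\<forall>u\<in>V. \<forall>w\<in>V. (u, w) \<in> {(a, b). adj D a b}\<^sup>*)"

definition graph_bipartite :: "'v set \<Rightarrow> ('v \<times> 'v) set \<Rightarrow> bool" where
  "graph_bipartite V D \<longleftrightarrow> (\<exists>c :: 'v \<Rightarrow> bool. \<forall>u w. adj D u w \<longrightarrow> c u \<noteq> c w)"

text \<open>f e x is the value of the function on edge e at the coordinate x in [0,1].
  qg_eigfun V D lam f: f is in the domain of the standard (Kirchhoff) Laplacian
  and L f = lam f (as elements of L^2).  Domain: on every edge f_e is C^1 on [0,1]
  with derivative f'_e, f'_e is absolutely continuous with derivative g_e in L^2,
  i.e. f'_e x = f'_e 0 + integral of g_e over [0,x]; then L f = - g (edgewise).
  f is continuous at every vertex and satisfies the Kirchhoff condition.\<close>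

definition qg_eigfun :: "'v set \<Rightarrow> ('v \<times> 'v) set \<Rightarrow> real \<Rightarrow> ('v \<times> 'v \<Rightarrow> real \<Rightarrow> complex) \<Rightarrow> bool" where
  "qg_eigfun V D lam f \<longleftrightarrow>
     (\<forall>e. e \<notin> D \<longrightarrow> (\<forall>x. f e x = 0)) \<and>
     (\<forall>e x. x \<notin> {0..1} \<longrightarrow> f e x = 0) \<and>
     (\<forall>u w u' w'. (u, w) \<in> D \<longrightarrow> (u', w') \<in> D \<longrightarrow>
        (u = u' \<longrightarrow> f (u, w) 0 = f (u', w') 0) \<and>
        (u = w' \<longrightarrow> f (u, w) 0 = f (u', w') 1) \<and>
        (w = w' \<longrightarrow> f (u, w) 1 = f (u', w') 1)) \<and>
     (\<exists>f' g :: 'v \<times> 'v \<Rightarrow> real \<Rightarrow> complex.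
        (\<forall>e\<in>D.
           (\<forall>x\<in>{0..1}. (f e has_vector_derivative f' e x) (at x within {0..1})) \<and>
           continuous_on {0..1} (f' e) \<and>
           g e absolutely_integrable_on {0..1} \<and>
           (\<lambda>x. (norm (g e x))\<^sup>2) integrable_on {0..1} \<and>
           (\<forall>x\<in>{0..1}. f' e x = f' e 0 + integral {0..x} (g e)) \<and>
           negligible {x \<in> {0..1}. - g e x \<noteq> complex_of_real lam * f e x}) \<and>
        (\<forall>v\<in>V. (\<Sum>w\<in>{w. (v, w) \<in> D}. f' (v, w) 0) + (\<Sum>u\<in>{u. (u, v) \<in> D}. - f' (u, v) 1) = 0))"

definition qg_eigenspace :: "'v set \<Rightarrow> ('v \<times> 'v) set \<Rightarrow> real \<Rightarrow> ('v \<times> 'v \<Rightarrow> real \<Rightarrow> complex) set" where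
  "qg_eigenspace V D lam = {f. qg_eigfun V D lam f}"

definition qg_is_eigenvalue :: "'v set \<Rightarrow> ('v \<times> 'v) set \<Rightarrow> real \<Rightarrow> bool" where
  "qg_is_eigenvalue V D lam \<longleftrightarrow> qg_eigenspace V D lam \<noteq> {0}"

text \<open>Multiplicity: complex dimension of the eigenspace.\<close>
definition qg_mult :: "'v set \<Rightarrow> ('v \<times> 'v) set \<Rightarrow> real \<Rightarrow> nat" where
  "qg_mult V D lam =
     vector_space.dim (\<lambda>(c::complex) (f :: 'v \<times> 'v \<Rightarrow> real \<Rightarrow> complex). \<lambda>e x. c * f e x)
       (qg_eigenspace V D lam)"

end

theory Submission
  imports Defs "HOL-Computational_Algebra.Fundamental_Theorem_Algebra"
begin

text \<open>
  If \<open>sin \<omega> \<noteq> 0\<close>, a solution of \<open>f'' = - \<omega>\<^sup>2 f\<close> on an edge is determined by its two end values, so an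
  eigenfunction for \<open>\<omega>\<^sup>2\<close> is the same thing as a vertex function \<open>\<phi>\<close>; the Kirchhoff condition becomes
  \<open>A \<phi> = cos \<omega> \<phi>\<close>, where \<open>A\<close> averages over neighbours. The operator \<open>A\<close> is self-adjoint for the
  inner product weighted by the degrees, hence diagonalisable, with spectrum in \<open>[-1, 1]\<close>; for a connected
  bipartite graph \<open>1\<close> and \<open>-1\<close> are simple eigenvalues, which leaves \<open>N - 2\<close> in \<open>(-1, 1)\<close>. The
  cosine maps both \<open>(0, \<pi>)\<close> and \<open>(\<pi>, 2\<pi>)\<close> bijectively onto \<open>(-1, 1)\<close>, and
  \<open>cos (2\<pi> - \<omega>) = cos \<omega>\<close> pairs the two bands.
\<close>

section \<open>Diagonalisation of self-adjoint operators\<close>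

text \<open>Scaling is an explicit parameter so that function spaces with pointwise scaling can be
  instances. Finite dimension is imposed only on invariant subspaces \<open>W\<close>, as a bound
  \<open>n\<close> on the size of independent sets.\<close>

locale complex_operator = vector_space scale
  for scale :: "complex \<Rightarrow> 'b::ab_group_add \<Rightarrow> 'b" (infixr "*\<^sub>C" 75) +
  fixes T :: "'b \<Rightarrow> 'b"
  assumes T_add: "T (x + y) = T x + T y"
    and T_scale: "T (c *\<^sub>C x) = c *\<^sub>C T x"
begin

lemma T_zero: "T 0 = 0"
  using T_scale[of 0 0] by simp

lemma T_sum: "T (\<Sum>i\<in>A. g i) = (\<Sum>i\<in>A. T (g i))"
  by (induction A rule: infinite_finite_induct) (auto simp: T_zero T_add)

section \<open>Polynomials in an operator and existence of eigenvectors\<close>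

definition poly_apply :: "complex poly \<Rightarrow> 'b \<Rightarrow> 'b" where
  "poly_apply p x = (\<Sum>i\<le>degree p. coeff p i *\<^sub>C (T ^^ i) x)"

text \<open>Coefficients beyond the degree vanish, so polynomials of different degrees can be
  evaluated over a common index range.\<close>

lemma poly_apply_bound:
  assumes "degree p \<le> n"
  shows "poly_apply p x = (\<Sum>i\<le>n. coeff p i *\<^sub>C (T ^^ i) x)"
  unfolding poly_apply_def
  by (rule sum.mono_neutral_left) (use assms in \<open>auto simp: coeff_eq_0\<close>)

lemma poly_apply_pCons: "poly_apply (pCons c q) x = c *\<^sub>C x + T (poly_apply q x)"
proof -
  have "poly_apply (pCons c q) x = (\<Sum>i\<le>Suc (degree q). coeff (pCons c q) i *\<^sub>C (T ^^ i) x)"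
    by (rule poly_apply_bound) (simp add: degree_pCons_le)
  also have "\<dots> = c *\<^sub>C x + (\<Sum>i\<le>degree q. coeff q i *\<^sub>C (T ^^ Suc i) x)"
    by (subst sum.atMost_Suc_shift) simp
  also have "\<dots> = c *\<^sub>C x + T (poly_apply q x)"
    by (simp add: poly_apply_def T_sum T_scale)
  finally show ?thesis .
qed

lemma poly_apply_diff: "poly_apply (p - q) x = poly_apply p x - poly_apply q x"
proof -
  let ?n = "max (degree p) (degree q)"
  have "degree (p - q) \<le> ?n"
    by (rule degree_diff_le) auto
  then show ?thesis
    by (simp add: poly_apply_bound[of _ ?n] scale_left_diff_distrib sum_subtractf)
qed

lemma poly_apply_smult: "poly_apply (smult a p) x = a *\<^sub>C poly_apply p x"
  by (subst poly_apply_bound[OF degree_smult_le]) (simp add: poly_apply_def scale_sum_right)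

lemma poly_apply_linear_factor:
  "poly_apply ([:- a, 1:] * q) x = T (poly_apply q x) - a *\<^sub>C poly_apply q x"
proof -
  have "[:- a, 1:] * q = pCons 0 q - smult a q"
    by simp
  then show ?thesis
    by (simp add: poly_apply_diff poly_apply_pCons poly_apply_smult)
qed

lemma poly_apply_closed:
  assumes "subspace W" "T ` W \<subseteq> W" "x \<in> W"
  shows "poly_apply p x \<in> W"
proof -
  have "(T ^^ i) x \<in> W" for i
    by (induction i) (use assms in auto)
  then show ?thesis
    unfolding poly_apply_def using assms(1) by (intro subspace_sum subspace_scale) auto
qed

text \<open>The \<open>n + 1\<close> vectors \<open>x, T x, ..., T^n x\<close> lie in
  \<open>W\<close>, one more than an independent set can hold; a linear relation between them is a
  polynomial that kills \<open>x\<close>.\<close>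

lemma annihilating_poly_exists:
  assumes "subspace W" "T ` W \<subseteq> W" "x \<in> W"
    and bound: "\<forall>S\<subseteq>W. independent S \<longrightarrow> finite S \<and> card S \<le> n"
  obtains p where "p \<noteq> 0" "poly_apply p x = 0"
proof (cases "inj_on (\<lambda>i. (T ^^ i) x) {..n}")
  \<comment> \<open>Coinciding iterates may leave too few vectors for the dimension bound to force a
    relation; instead the difference of two monomials annihilates \<open>x\<close> directly.\<close>
  case False
  then obtain i j where ij: "i \<noteq> j" "(T ^^ i) x = (T ^^ j) x"
    by (auto simp: inj_on_def)
  have mon: "poly_apply (monom 1 k) x = (T ^^ k) x" for k
  proof -
    have "poly_apply (monom 1 k) x = (\<Sum>i\<le>k. coeff (monom 1 k) i *\<^sub>C (T ^^ i) x)"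
      by (rule poly_apply_bound) (simp add: degree_monom_eq)
    also have "\<dots> = (\<Sum>i\<in>{k}. (T ^^ i) x)"
      by (rule sum.mono_neutral_cong_right) auto
    finally show ?thesis by simp
  qed
  have "coeff (monom (1::complex) i - monom 1 j) i \<noteq> 0"
    using ij by simp
  then have "monom (1::complex) i - monom 1 j \<noteq> 0"
    by force
  moreover have "poly_apply (monom 1 i - monom 1 j) x = 0"
    by (simp add: poly_apply_diff mon ij)
  ultimately show ?thesis by (rule that)
next
  case True
  let ?S = "(\<lambda>i. (T ^^ i) x) ` {..n}"
  have mem: "(T ^^ i) x \<in> W" for i
    by (induction i) (use assms in auto)
  have "card ?S = Suc n"
    using True by (simp add: card_image)
  then have "dependent ?S"
    using bound mem by (metis Suc_n_not_le_n image_subsetI)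
  then obtain u where u: "(\<Sum>v\<in>?S. u v *\<^sub>C v) = 0" "\<exists>v\<in>?S. u v \<noteq> 0"
    using dependent_finite[of ?S] by blast
  \<comment> \<open>The relation \<open>u\<close> assigns coefficients to vectors; injectivity of
    the iterates turns it into coefficients indexed by exponents.\<close>
  define p where "p = (\<Sum>i\<le>n. monom (u ((T ^^ i) x)) i)"
  have c: "coeff p i = (if i \<le> n then u ((T ^^ i) x) else 0)" for i
    unfolding p_def by (simp add: coeff_sum)
  have "p \<noteq> 0"
  proof
    assume "p = 0"
    then have "\<forall>i\<le>n. u ((T ^^ i) x) = 0"
      using c by (metis coeff_0)
    then show False using u(2) by auto
  qed
  moreover have "poly_apply p x = (\<Sum>i\<le>n. coeff p i *\<^sub>C (T ^^ i) x)"
    by (rule poly_apply_bound) (use c in \<open>auto intro!: degree_le\<close>)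
  then have "poly_apply p x = 0"
    using u(1) unfolding sum.reindex[OF True] by (simp add: c)
  ultimately show ?thesis by (rule that)
qed

text \<open>An annihilating polynomial of \<open>x\<close> of least degree has a complex root
  \<open>a\<close>, hence the form (X - a) q. Minimality makes q(T) x nonzero, and T - a sends it to
  zero.\<close>

lemma eigenvector_exists:
  assumes "subspace W" "T ` W \<subseteq> W" "W \<noteq> {0}"
    and bound: "\<forall>S\<subseteq>W. independent S \<longrightarrow> finite S \<and> card S \<le> n"
  obtains y a where "y \<in> W" "y \<noteq> 0" "T y = a *\<^sub>C y"
proof -
  obtain x where x: "x \<in> W" "x \<noteq> 0"
    using assms(1,3) subspace_0 by blast
  obtain p0 where p0: "p0 \<noteq> 0" "poly_apply p0 x = 0"
    by (rule annihilating_poly_exists[OF assms(1,2) x(1) bound])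
  obtain p where p: "p \<noteq> 0" "poly_apply p x = 0"
    and min: "\<And>q. q \<noteq> 0 \<Longrightarrow> poly_apply q x = 0 \<Longrightarrow> degree p \<le> degree q"
    using ex_has_least_nat[of "\<lambda>p. p \<noteq> 0 \<and> poly_apply p x = 0" p0 degree] p0 by auto
  have "degree p \<noteq> 0"
  proof
    assume "degree p = 0"
    then obtain c where "p = [:c:]"
      by (rule degree_eq_zeroE)
    then show False
      using p x by (auto simp: poly_apply_def)
  qed
  then have "\<not> constant (poly p)"
    by (simp add: constant_degree)
  then obtain a where "poly p a = 0"
    using fundamental_theorem_of_algebra by blast
  then obtain q where q: "p = [:- a, 1:] * q"
    unfolding poly_eq_0_iff_dvd by (rule dvdE)
  have "q \<noteq> 0" using p q by auto
  then have "degree p = Suc (degree q)"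
    unfolding q by (subst degree_mult_eq) auto
  with min[of q] \<open>q \<noteq> 0\<close> have "poly_apply q x \<noteq> 0"
    by auto
  moreover have "T (poly_apply q x) = a *\<^sub>C poly_apply q x"
    using p(2) unfolding q poly_apply_linear_factor by simp
  ultimately show ?thesis
    by (rule that[OF poly_apply_closed[OF assms(1,2) x(1)]])
qed

text \<open>Induction on the dimension bound: split off one eigenvector \<open>x\<close> and pass to
  its orthogonal complement in \<open>W\<close>, which is invariant because \<open>T\<close> is
  self-adjoint. Definiteness is asked on \<open>W\<close> only, since the form used later does not
  see values of functions outside the vertex set.\<close>

lemma eigenbasis_exists:
  fixes ip :: "'b \<Rightarrow> 'b \<Rightarrow> complex"
  assumes "subspace W" "T ` W \<subseteq> W"
    and bound: "\<forall>S\<subseteq>W. independent S \<longrightarrow> finite S \<and> card S \<le> n"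
    and ip_add: "\<And>x y z. ip (x + y) z = ip x z + ip y z"
    and ip_scale: "\<And>c x z. ip (c *\<^sub>C x) z = c * ip x z"
    and ip_cnj: "\<And>c x z. ip z (c *\<^sub>C x) = cnj c * ip z x"
    and ip_definite: "\<And>x. x \<in> W \<Longrightarrow> ip x x = 0 \<Longrightarrow> x = 0"
    and self_adjoint: "\<And>x y. x \<in> W \<Longrightarrow> y \<in> W \<Longrightarrow> ip (T x) y = ip x (T y)"
  obtains B where "B \<subseteq> W" "independent B" "span B = W" "\<And>b. b \<in> B \<Longrightarrow> \<exists>a. T b = a *\<^sub>C b"
proof -
  have "\<exists>B\<subseteq>W. independent B \<and> span B = W \<and> (\<forall>b\<in>B. \<exists>a. T b = a *\<^sub>C b)"
    using assms(1,2,3) ip_definite self_adjoint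
  proof (induction n arbitrary: W)
    case 0
    have "W = {0}"
    proof (rule ccontr)
      assume "W \<noteq> {0}"
      then obtain x where "x \<in> W" "x \<noteq> 0"
        using subspace_0[OF 0(1)] by blast
      then show False
        using 0(3)[rule_format, of "{x}"] by auto
    qed
    then show ?case by (intro exI[of _ "{}"]) (auto simp: independent_empty)
  next
    case (Suc n)
    show ?case
    proof (cases "W = {0}")
      case True
      then show ?thesis by (intro exI[of _ "{}"]) (auto simp: independent_empty)
    next
      case False
      obtain x a where x: "x \<in> W" "x \<noteq> 0" "T x = a *\<^sub>C x"
        by (rule eigenvector_exists[OF Suc.prems(1,2) False Suc.prems(3)])
      have xx: "ip x x \<noteq> 0"
        using Suc.prems(4) x by blast
      have ip0: "ip 0 x = 0"
        using ip_scale[of 0 0 x] by simp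
      define W' where "W' = {y \<in> W. ip y x = 0}"
      have sub': "subspace W'"
        using Suc.prems(1) unfolding W'_def
        by (auto simp: subspace_def ip_add ip_scale ip0)
      have xW': "x \<notin> W'"
        using xx by (simp add: W'_def)
      have "\<exists>B\<subseteq>W'. independent B \<and> span B = W' \<and> (\<forall>b\<in>B. \<exists>a. T b = a *\<^sub>C b)"
      proof (rule Suc.IH)
        show "subspace W'" by fact
        \<comment> \<open>For \<open>y\<close> in \<open>W'\<close>,
          \<open>ip (T y) x = ip y (T x) = cnj a * ip y x = 0\<close>.\<close>
        show "T ` W' \<subseteq> W'"
          using Suc.prems(2,5) x by (auto simp: W'_def ip_cnj)
        show "\<forall>S\<subseteq>W'. independent S \<longrightarrow> finite S \<and> card S \<le> n"
        proof (intro allI impI)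
          fix S assume S: "S \<subseteq> W'" "independent S"
          \<comment> \<open>Adjoining \<open>x\<close> to an independent subset of \<open>W'\<close>
            gives a larger independent subset of \<open>W\<close>, which lowers the bound by
            one.\<close>
          have "x \<notin> span S"
            using span_minimal[OF S(1) sub'] xW' by auto
          then have ind: "independent (insert x S)"
            using S(2) by (rule independent_insertI)
          have "insert x S \<subseteq> W"
            using S(1) x(1) unfolding W'_def by auto
          then have "finite (insert x S) \<and> card (insert x S) \<le> Suc n"
            using ind Suc.prems(3)[rule_format, of "insert x S"] by simp
          moreover have "x \<notin> S" using xW' S(1) by auto
          ultimately show "finite S \<and> card S \<le> n" by auto
        qed
      qed (use Suc.prems(4,5) in \<open>auto simp: W'_def\<close>)
      then obtain B where B: "B \<subseteq> W'" "independent B" "span B = W'" "\<forall>b\<in>B. \<exists>a. T b = a *\<^sub>C b"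
        by blast
      have "independent (insert x B)"
        using B xW' by (intro independent_insertI) auto
      moreover have sub: "insert x B \<subseteq> W"
        using B x by (auto simp: W'_def)
      moreover have "W \<subseteq> span (insert x B)"
      proof
        fix y assume y: "y \<in> W"
        \<comment> \<open>The coefficient of the orthogonal projection of \<open>y\<close> onto
          \<open>x\<close>; removing it leaves a vector of \<open>W'\<close>.\<close>
        define c where "c = ip y x / ip x x"
        have "ip (y - c *\<^sub>C x) x = 0"
          using ip_add[of "y - c *\<^sub>C x" "c *\<^sub>C x" x] xx by (simp add: ip_scale c_def)
        then have "y - c *\<^sub>C x \<in> W'"
          using y x Suc.prems(1) by (auto simp: W'_def intro!: subspace_diff subspace_scale)
        then show "y \<in> span (insert x B)"
          using B(3) span_breakdown_eq by blast
      qed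
      ultimately have "span (insert x B) = W"
        using Suc.prems(1) by (simp add: span_subspace)
      then show ?thesis
        using \<open>independent (insert x B)\<close> sub B(4) x(3) by (intro exI[of _ "insert x B"]) auto
    qed
  qed
  then show ?thesis using that by blast
qed

text \<open>Expanding an eigenvector in the eigenbasis and comparing coefficients gives
  \<open>(\<alpha> b - a) * u b = 0\<close>, so only basis vectors with eigenvalue \<open>a\<close>
  survive.\<close>

lemma eigenspace_basis:
  assumes "finite B" "independent B" and eig: "\<And>b. b \<in> B \<Longrightarrow> T b = \<alpha> b *\<^sub>C b"
  shows "span {b \<in> B. \<alpha> b = a} = {x \<in> span B. T x = a *\<^sub>C x}"
proof
  have "subspace {x \<in> span B. T x = a *\<^sub>C x}"
    by (auto simp: subspace_def span_zero span_add span_scale T_zero T_add T_scale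
        scale_right_distrib scale_left_commute)
  moreover have "{b \<in> B. \<alpha> b = a} \<subseteq> {x \<in> span B. T x = a *\<^sub>C x}"
    using eig by (auto intro: span_base)
  ultimately show "span {b \<in> B. \<alpha> b = a} \<subseteq> {x \<in> span B. T x = a *\<^sub>C x}"
    by (rule span_minimal[rotated])
next
  show "{x \<in> span B. T x = a *\<^sub>C x} \<subseteq> span {b \<in> B. \<alpha> b = a}"
  proof clarify
    fix x assume x: "x \<in> span B" "T x = a *\<^sub>C x"
    then obtain u where u: "x = (\<Sum>b\<in>B. u b *\<^sub>C b)"
      using span_finite[OF assms(1)] by auto
    have "(\<Sum>b\<in>B. ((\<alpha> b - a) * u b) *\<^sub>C b) = T x - a *\<^sub>C x"
      unfolding u T_sum scale_sum_right sum_subtractf[symmetric]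
      by (rule sum.cong) (auto simp: T_scale eig scale_left_diff_distrib algebra_simps)
    then have "(\<Sum>b\<in>B. ((\<alpha> b - a) * u b) *\<^sub>C b) = 0"
      using x by simp
    then have "(\<alpha> b - a) * u b = 0" if "b \<in> B" for b
      using independentD[OF assms(2,1) order.refl _ that, of "\<lambda>b. (\<alpha> b - a) * u b"] by blast
    then have "x = (\<Sum>b\<in>{b \<in> B. \<alpha> b = a}. u b *\<^sub>C b)"
      unfolding u using assms(1) by (intro sum.mono_neutral_right) auto
    then show "x \<in> span {b \<in> B. \<alpha> b = a}"
      by (auto intro!: span_sum span_scale intro: span_base)
  qed
qed

end

section \<open>The averaging operator on vertex functions\<close>

text \<open>Connectedness together with a second vertex rules out isolated vertices, so all degrees
  are positive and averages over neighbours make sense.\<close>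

locale connected_graph =
  fixes V :: "'v set" and D :: "('v \<times> 'v) set"
  assumes simple: "simple_oriented_graph V D"
    and connected: "graph_connected V D"
    and two_vertices: "2 \<le> card V"
begin

definition nbrs :: "'v \<Rightarrow> 'v set" where
  "nbrs v = {w. adj D v w}"

text \<open>The transition operator of simple random walk. The value 0 outside \<open>V\<close>
  keeps the space of functions supported on \<open>V\<close> invariant.\<close>

definition avg :: "('v \<Rightarrow> complex) \<Rightarrow> 'v \<Rightarrow> complex" where
  "avg \<phi> v = (if v \<in> V then (\<Sum>w\<in>nbrs v. \<phi> w) / of_nat (card (nbrs v)) else 0)"

text \<open>A model of the complex functions on \<open>V\<close> inside the full function type;
  fixing the values outside \<open>V\<close> makes its dimension \<open>card V\<close>.\<close>

definition vertex_functions :: "('v \<Rightarrow> complex) set" where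
  "vertex_functions = {\<phi>. \<forall>v. v \<notin> V \<longrightarrow> \<phi> v = 0}"

definition avg_eigenspace :: "real \<Rightarrow> ('v \<Rightarrow> complex) set" where
  "avg_eigenspace a = {\<phi> \<in> vertex_functions. avg \<phi> = (\<lambda>v. complex_of_real a * \<phi> v)}"

text \<open>The degree weight cancels the denominator in \<open>avg\<close>, which leaves sums over
  oriented edges.\<close>

definition deg_inner :: "('v \<Rightarrow> complex) \<Rightarrow> ('v \<Rightarrow> complex) \<Rightarrow> complex" where
  "deg_inner \<phi> \<psi> = (\<Sum>v\<in>V. of_nat (card (nbrs v)) * (\<phi> v * cnj (\<psi> v)))"

lemma finite_V: "finite V"
  using simple by (simp add: simple_oriented_graph_def)

lemma V_nonempty: "V \<noteq> {}"
  using two_vertices by auto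

lemma nbrs_subset: "nbrs v \<subseteq> V"
  using simple by (auto simp: simple_oriented_graph_def nbrs_def adj_def)

lemma finite_nbrs: "finite (nbrs v)"
  using nbrs_subset finite_V by (rule finite_subset)

lemma nbrs_sym: "w \<in> nbrs v \<longleftrightarrow> v \<in> nbrs w"
  by (auto simp: nbrs_def adj_def)

text \<open>A path from \<open>v\<close> to some other vertex has a first edge.\<close>

lemma nbrs_nonempty:
  assumes "v \<in> V"
  shows "nbrs v \<noteq> {}"
proof -
  have "V \<noteq> {v}"
    using two_vertices by auto
  then obtain u where "u \<in> V" "u \<noteq> v"
    using assms by blast
  then have "(v, u) \<in> {(a, b). adj D a b}\<^sup>*"
    using connected assms by (auto simp: graph_connected_def)
  then obtain w where "adj D v w"
    using \<open>u \<noteq> v\<close> by (cases rule: converse_rtranclE) auto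
  then show ?thesis by (auto simp: nbrs_def)
qed

lemma card_nbrs_pos: "v \<in> V \<Longrightarrow> 0 < card (nbrs v)"
  using nbrs_nonempty finite_nbrs by (simp add: card_gt_0_iff)

sublocale vx: complex_operator "\<lambda>(c::complex) (\<phi>::'v \<Rightarrow> complex) v. c * \<phi> v" avg
  by unfold_locales
    (auto simp: fun_eq_iff avg_def algebra_simps sum.distrib sum_distrib_left add_divide_distrib)

text \<open>Clearing the denominator brings the eigenvalue equation into the form that the Kirchhoff
  condition takes.\<close>

lemma avg_eigenspace_iff:
  "\<phi> \<in> avg_eigenspace a \<longleftrightarrow> \<phi> \<in> vertex_functions \<and>
     (\<forall>v\<in>V. (\<Sum>w\<in>nbrs v. \<phi> w) = of_real a * of_nat (card (nbrs v)) * \<phi> v)"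
proof -
  have "avg \<phi> v = of_real a * \<phi> v \<longleftrightarrow> (\<Sum>w\<in>nbrs v. \<phi> w) = of_real a * of_nat (card (nbrs v)) * \<phi> v"
    if "v \<in> V" for v
    using card_nbrs_pos[OF that] that by (auto simp: avg_def field_simps)
  moreover have "avg \<phi> v = of_real a * \<phi> v" if "v \<notin> V" "\<phi> \<in> vertex_functions" for v
    using that by (simp add: avg_def vertex_functions_def)
  ultimately show ?thesis
    unfolding avg_eigenspace_def fun_eq_iff by blast
qed

lemma subspace_avg_eigenspace: "vx.subspace (avg_eigenspace a)"
  by (auto simp: vx.subspace_def avg_eigenspace_def vertex_functions_def vx.T_zero vx.T_add vx.T_scale
      fun_eq_iff algebra_simps)

text \<open>Both sides run over all ordered pairs of adjacent vertices, and adjacency is symmetric,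
  so every pair can be reversed.\<close>

lemma sum_nbrs_swap:
  fixes F :: "'v \<Rightarrow> 'v \<Rightarrow> 'c::comm_monoid_add"
  shows "(\<Sum>v\<in>V. \<Sum>w\<in>nbrs v. F v w) = (\<Sum>v\<in>V. \<Sum>w\<in>nbrs v. F w v)"
proof -
  have *: "(\<Sum>w\<in>nbrs v. G w) = (\<Sum>w\<in>V. if w \<in> nbrs v then G w else 0)" for v and G :: "'v \<Rightarrow> 'c"
    using nbrs_subset[of v] finite_V by (simp add: sum.inter_restrict[symmetric] Int_absorb1)
  have "(\<Sum>v\<in>V. \<Sum>w\<in>nbrs v. F v w) = (\<Sum>w\<in>V. \<Sum>v\<in>V. if w \<in> nbrs v then F v w else 0)"
    unfolding * by (rule sum.swap)
  also have "\<dots> = (\<Sum>v\<in>V. \<Sum>w\<in>nbrs v. F w v)"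
    unfolding * by (intro sum.cong refl) (auto simp: nbrs_sym)
  finally show ?thesis .
qed

lemma subspace_vertex_functions: "vx.subspace vertex_functions"
  by (auto simp: vx.subspace_def vertex_functions_def)

lemma avg_closed: "avg ` vertex_functions \<subseteq> vertex_functions"
  by (auto simp: vertex_functions_def avg_def)

lemma card_nbrs_avg: "v \<in> V \<Longrightarrow> of_nat (card (nbrs v)) * avg \<phi> v = (\<Sum>w\<in>nbrs v. \<phi> w)"
  using card_nbrs_pos[of v] by (simp add: avg_def)

text \<open>After cancelling degrees, both sides are sums over oriented edges that differ only by
  the reversal of each edge.\<close>

lemma avg_self_adjoint: "deg_inner (avg \<phi>) \<psi> = deg_inner \<phi> (avg \<psi>)"
proof -
  have "deg_inner (avg \<phi>) \<psi> = (\<Sum>v\<in>V. \<Sum>w\<in>nbrs v. \<phi> w * cnj (\<psi> v))"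
    unfolding deg_inner_def
    by (intro sum.cong) (simp_all add: card_nbrs_avg mult.assoc[symmetric] sum_distrib_right)
  also have "\<dots> = (\<Sum>v\<in>V. \<Sum>w\<in>nbrs v. \<phi> v * cnj (\<psi> w))"
    by (rule sum_nbrs_swap)
  also have "\<dots> = (\<Sum>v\<in>V. \<phi> v * cnj (of_nat (card (nbrs v)) * avg \<psi> v))"
    by (intro sum.cong) (simp_all add: card_nbrs_avg sum_distrib_left del: complex_cnj_mult)
  also have "\<dots> = deg_inner \<phi> (avg \<psi>)"
    unfolding deg_inner_def by (simp add: mult_ac)
  finally show ?thesis .
qed

section \<open>Energy estimate and the extremal eigenvalues\<close>

lemma deg_inner_self:
  "deg_inner \<phi> \<phi> = of_real (\<Sum>v\<in>V. real (card (nbrs v)) * (cmod (\<phi> v))\<^sup>2)"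
  unfolding deg_inner_def of_real_sum by (intro sum.cong) (simp_all add: complex_norm_square[symmetric])

lemma deg_norm_pos:
  assumes "\<phi> \<in> vertex_functions" "\<phi> \<noteq> 0"
  shows "0 < (\<Sum>v\<in>V. real (card (nbrs v)) * (cmod (\<phi> v))\<^sup>2)"
proof -
  obtain v where v: "v \<in> V" "\<phi> v \<noteq> 0"
    using assms by (auto simp: vertex_functions_def fun_eq_iff)
  show ?thesis
    using card_nbrs_pos[OF v(1)] v by (intro sum_pos2[OF finite_V v(1)]) auto
qed

text \<open>The identity \<open>\<parallel>x - s y\<parallel>\<^sup>2 = \<parallel>x\<parallel>\<^sup>2 + \<parallel>y\<parallel>\<^sup>2 - 2 s Re (x cnj y)\<close> for \<open>s = \<plusminus>1\<close>, summed over
  oriented edges, bounds the spectrum (\<open>s * a \<le> 1\<close>) and identifies the extremal eigenfunctions.\<close>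

lemma energy_identity:
  fixes s a :: real
  assumes "s\<^sup>2 = 1" "\<phi> \<in> avg_eigenspace a"
  shows "(\<Sum>v\<in>V. \<Sum>w\<in>nbrs v. (cmod (\<phi> v - of_real s * \<phi> w))\<^sup>2)
    = 2 * (1 - s * a) * (\<Sum>v\<in>V. real (card (nbrs v)) * (cmod (\<phi> v))\<^sup>2)"
proof -
  let ?N = "\<Sum>v\<in>V. real (card (nbrs v)) * (cmod (\<phi> v))\<^sup>2"
  have exp: "(cmod (x - of_real s * y))\<^sup>2 = (cmod x)\<^sup>2 + (cmod y)\<^sup>2 - 2 * s * Re (x * cnj y)" for x y
  proof -
    have "(cmod (x - of_real s * y))\<^sup>2 = (cmod x)\<^sup>2 + s\<^sup>2 * (cmod y)\<^sup>2 - 2 * s * Re (x * cnj y)"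
      unfolding cmod_power2 by (simp add: power2_eq_square algebra_simps)
    then show ?thesis by (simp add: assms)
  qed
  have 1: "(\<Sum>v\<in>V. \<Sum>w\<in>nbrs v. (cmod (\<phi> v))\<^sup>2) = ?N"
    by simp
  \<comment> \<open>Reversing the edges counts each vertex once per neighbour, that is, with its
    degree as weight.\<close>
  have 2: "(\<Sum>v\<in>V. \<Sum>w\<in>nbrs v. (cmod (\<phi> w))\<^sup>2) = ?N"
    using sum_nbrs_swap[of "\<lambda>v w. (cmod (\<phi> w))\<^sup>2"] by simp
  have 3: "(\<Sum>v\<in>V. \<Sum>w\<in>nbrs v. Re (\<phi> v * cnj (\<phi> w))) = a * ?N"
    unfolding sum_distrib_left
  proof (intro sum.cong refl)
    fix v assume "v \<in> V"
    then have eq: "(\<Sum>w\<in>nbrs v. \<phi> w) = of_real a * of_nat (card (nbrs v)) * \<phi> v"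
      using assms(2) avg_eigenspace_iff by blast
    have "(\<Sum>w\<in>nbrs v. Re (\<phi> v * cnj (\<phi> w))) = Re (\<phi> v * cnj (\<Sum>w\<in>nbrs v. \<phi> w))"
      by (simp only: Re_sum cnj_sum sum_distrib_left)
    also have "\<dots> = Re (of_real (a * real (card (nbrs v))) * (\<phi> v * cnj (\<phi> v)))"
      unfolding eq by (simp add: algebra_simps)
    also have "\<dots> = a * (real (card (nbrs v)) * (cmod (\<phi> v))\<^sup>2)"
      unfolding complex_norm_square[symmetric] by simp
    finally show "(\<Sum>w\<in>nbrs v. Re (\<phi> v * cnj (\<phi> w))) = a * (real (card (nbrs v)) * (cmod (\<phi> v))\<^sup>2)" .
  qed
  have "(\<Sum>v\<in>V. \<Sum>w\<in>nbrs v. (cmod (\<phi> v - of_real s * \<phi> w))\<^sup>2)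
    = ?N + ?N - 2 * s * (a * ?N)"
    unfolding exp sum_subtractf sum.distrib sum_distrib_left[symmetric] 1 2 3 ..
  then show ?thesis by (simp add: algebra_simps)
qed

lemma avg_eigenvalue_abs_le_1:
  assumes "\<phi> \<in> avg_eigenspace a" "\<phi> \<noteq> 0"
  shows "\<bar>a\<bar> \<le> 1"
proof -
  have pos: "0 < (\<Sum>v\<in>V. real (card (nbrs v)) * (cmod (\<phi> v))\<^sup>2)"
    using assms deg_norm_pos by (simp add: avg_eigenspace_def)
  have "0 \<le> 2 * (1 - s * a)" if "s\<^sup>2 = 1" for s :: real
  proof -
    have "0 \<le> (\<Sum>v\<in>V. \<Sum>w\<in>nbrs v. (cmod (\<phi> v - of_real s * \<phi> w))\<^sup>2)"
      by (intro sum_nonneg) auto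
    then show ?thesis
      using energy_identity[OF that assms(1)] pos by (simp add: zero_le_mult_iff)
  qed
  \<comment> \<open>The sign \<open>s = 1\<close> gives the upper bound on \<open>a\<close>, the
    sign \<open>s = -1\<close> the lower one.\<close>
  from this[of 1] this[of "-1"] show ?thesis by auto
qed

text \<open>For the eigenvalue \<open>s\<close> the factor \<open>1 - s * s\<close> vanishes, so the
  energy is zero, and with it each of its nonnegative edge terms.\<close>

lemma extremal_eigenfunction:
  assumes "s\<^sup>2 = 1" "\<phi> \<in> avg_eigenspace s" "w \<in> nbrs v"
  shows "\<phi> v = of_real s * \<phi> w"
proof -
  have "(\<Sum>v\<in>V. \<Sum>w\<in>nbrs v. (cmod (\<phi> v - of_real s * \<phi> w))\<^sup>2) = 0"
    using energy_identity[OF assms(1,2)] assms(1) by (simp add: power2_eq_square)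
  moreover have v: "v \<in> V"
    using assms(3) nbrs_subset nbrs_sym by blast
  ultimately have "(\<Sum>w\<in>nbrs v. (cmod (\<phi> v - of_real s * \<phi> w))\<^sup>2) = 0"
    using finite_V by (simp add: sum_nonneg_eq_0_iff sum_nonneg)
  then have "(cmod (\<phi> v - of_real s * \<phi> w))\<^sup>2 = 0"
    using assms(3) finite_nbrs by (simp add: sum_nonneg_eq_0_iff)
  then show ?thesis by simp
qed

text \<open>Meant for the constant \<open>\<eta>\<close> when \<open>s = 1\<close> and for the
  bipartition sign when \<open>s = -1\<close>. The product of \<open>\<phi>\<close> and
  \<open>\<eta>\<close> is preserved along each edge since \<open>s * s = 1\<close>, hence constant
  on \<open>V\<close> by connectedness; and \<open>\<eta>\<close> is its own inverse there.\<close>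

lemma extremal_eigenspace:
  assumes s: "s\<^sup>2 = 1"
    and \<eta>: "\<eta> \<in> vertex_functions" "\<And>v. v \<in> V \<Longrightarrow> \<eta> v = 1 \<or> \<eta> v = -1"
      "\<And>v w. w \<in> nbrs v \<Longrightarrow> \<eta> v = of_real s * \<eta> w"
  shows "avg_eigenspace s = vx.span {\<eta>}"
proof
  have ss: "of_real s * of_real s = (1::complex)"
    using s unfolding power2_eq_square by (simp flip: of_real_mult)
  show "avg_eigenspace s \<subseteq> vx.span {\<eta>}"
  proof
    fix \<phi> assume \<phi>: "\<phi> \<in> avg_eigenspace s"
    have step: "\<phi> v * \<eta> v = \<phi> w * \<eta> w" if "adj D v w" for v w
    proof -
      have "w \<in> nbrs v" using that by (simp add: nbrs_def)
      then have "\<phi> v = of_real s * \<phi> w" "\<eta> v = of_real s * \<eta> w"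
        by (fact extremal_eigenfunction[OF s \<phi>], fact \<eta>(3))
      then have "\<phi> v * \<eta> v = (of_real s * of_real s) * (\<phi> w * \<eta> w)"
        by (simp only: ac_simps)
      then show ?thesis by (simp add: ss)
    qed
    obtain r where r: "r \<in> V"
      using V_nonempty by auto
    have const: "\<phi> r * \<eta> r = \<phi> v * \<eta> v" if "v \<in> V" for v
    proof -
      have "(r, v) \<in> {(a, b). adj D a b}\<^sup>*"
        using connected r that by (auto simp: graph_connected_def)
      then show ?thesis
        by (induction rule: rtrancl_induct) (simp, metis step case_prodD mem_Collect_eq)
    qed
    have "\<phi> = (\<lambda>v. (\<phi> r * \<eta> r) * \<eta> v)"
    proof
      fix v
      show "\<phi> v = (\<phi> r * \<eta> r) * \<eta> v"
      proof (cases "v \<in> V")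
        case True
        then show ?thesis
          unfolding const[OF True] using \<eta>(2)[OF True] by auto
      next
        case False
        then show ?thesis
          using \<phi> \<eta>(1) by (auto simp: avg_eigenspace_def vertex_functions_def)
      qed
    qed
    then show "\<phi> \<in> vx.span {\<eta>}"
      unfolding vx.span_singleton by (rule range_eqI)
  qed
next
  have "\<eta> \<in> avg_eigenspace s"
    unfolding avg_eigenspace_iff
  proof (intro conjI ballI \<eta>(1))
    fix v assume "v \<in> V"
    have "(\<Sum>w\<in>nbrs v. \<eta> w) = (\<Sum>w\<in>nbrs v. of_real s * \<eta> v)"
    proof (intro sum.cong refl)
      fix w assume "w \<in> nbrs v"
      then have "v \<in> nbrs w" by (simp add: nbrs_sym)
      then show "\<eta> w = of_real s * \<eta> v" by (rule \<eta>(3))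
    qed
    then show "(\<Sum>w\<in>nbrs v. \<eta> w) = of_real s * of_nat (card (nbrs v)) * \<eta> v"
      by simp
  qed
  then show "vx.span {\<eta>} \<subseteq> avg_eigenspace s"
    using subspace_avg_eigenspace by (intro vx.span_minimal) auto
qed

section \<open>Spectral decomposition and the number of interior eigenvalues\<close>

lemma vertex_functions_basis:
  obtains B where "finite B" "card B = card V" "vx.independent B" "vx.span B = vertex_functions"
proof -
  \<comment> \<open>Indicator functions of single vertices: a linear combination takes at
    \<open>u\<close> the coefficient of \<open>\<delta> u\<close>, which yields both independence
    and spanning.\<close>
  define \<delta> :: "'v \<Rightarrow> 'v \<Rightarrow> complex" where "\<delta> u v = (if v = u then 1 else 0)" for u v
  have inj: "inj_on \<delta> V"
    by (rule inj_onI) (metis \<delta>_def zero_neq_one)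
  have sum: "(\<Sum>\<psi>\<in>\<delta> ` V. (\<lambda>v. c \<psi> * \<psi> v)) = (\<lambda>v. if v \<in> V then c (\<delta> v) else 0)" for c
  proof
    fix v
    have "(\<Sum>\<psi>\<in>\<delta> ` V. (\<lambda>v. c \<psi> * \<psi> v)) v = (\<Sum>u\<in>V. c (\<delta> u) * \<delta> u v)"
      unfolding sum.reindex[OF inj] by (induction V rule: infinite_finite_induct) auto
    also have "\<dots> = (if v \<in> V then c (\<delta> v) else 0)"
      using finite_V by (simp add: \<delta>_def if_distrib cong: if_cong)
    finally show "(\<Sum>\<psi>\<in>\<delta> ` V. (\<lambda>v. c \<psi> * \<psi> v)) v = (if v \<in> V then c (\<delta> v) else 0)" .
  qed
  have "vx.independent (\<delta> ` V)"
    using finite_V by (auto simp: vx.dependent_finite sum fun_eq_iff)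
  moreover have "vx.span (\<delta> ` V) = vertex_functions"
  proof
    show "vx.span (\<delta> ` V) \<subseteq> vertex_functions"
      by (rule vx.span_minimal[OF _ subspace_vertex_functions])
        (auto simp: \<delta>_def vertex_functions_def)
    show "vertex_functions \<subseteq> vx.span (\<delta> ` V)"
    proof
      fix \<phi> assume "\<phi> \<in> vertex_functions"
      then have "\<phi> = (\<Sum>\<psi>\<in>\<delta> ` V. (\<lambda>v. \<phi> (inv_into V \<delta> \<psi>) * \<psi> v))"
        unfolding sum using inj by (auto simp: vertex_functions_def fun_eq_iff)
      moreover have "(\<Sum>\<psi>\<in>\<delta> ` V. (\<lambda>v. \<phi> (inv_into V \<delta> \<psi>) * \<psi> v)) \<in> vx.span (\<delta> ` V)"
        by (rule vx.span_sum, rule vx.span_scale, rule vx.span_base)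
      ultimately show "\<phi> \<in> vx.span (\<delta> ` V)"
        by (rule ssubst[where P = "\<lambda>x. x \<in> vx.span (\<delta> ` V)"])
    qed
  qed
  ultimately show ?thesis
    using that[of "\<delta> ` V"] finite_V inj by (simp add: card_image)
qed

text \<open>Eigenvalues are recorded as a real function \<open>\<alpha>\<close> on an eigenbasis, so
  that eigenspaces are spans of level sets of \<open>\<alpha>\<close> and multiplicities become
  cardinalities. For \<open>a\<close> outside the spectrum the level set is empty and its span is
  \<open>{0}\<close>.\<close>

lemma avg_spectral_decomposition:
  obtains B :: "('v \<Rightarrow> complex) set" and \<alpha> :: "('v \<Rightarrow> complex) \<Rightarrow> real"
  where "finite B" "card B = card V" "vx.independent B"
    "\<forall>b\<in>B. \<bar>\<alpha> b\<bar> \<le> 1"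
    "\<forall>a. vx.span {b \<in> B. \<alpha> b = a} = avg_eigenspace a"
proof -
  obtain E where E: "finite E" "card E = card V" "vx.independent E" "vx.span E = vertex_functions"
    by (rule vertex_functions_basis)
  have bound: "\<forall>S\<subseteq>vertex_functions. vx.independent S \<longrightarrow> finite S \<and> card S \<le> card V"
    using vx.independent_span_bound[OF E(1)] E by auto
  obtain B where B: "B \<subseteq> vertex_functions" "vx.independent B" "vx.span B = vertex_functions"
    "\<And>b. b \<in> B \<Longrightarrow> \<exists>a. avg b = (\<lambda>v. a * b v)"
  proof (rule vx.eigenbasis_exists[OF subspace_vertex_functions avg_closed bound, of deg_inner])
    show "x = 0" if "x \<in> vertex_functions" "deg_inner x x = 0" for x
      using deg_norm_pos[OF that(1)] that(2) unfolding deg_inner_self of_real_eq_0_iff by force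
    show "deg_inner (avg x) y = deg_inner x (avg y)" for x y
      by (rule avg_self_adjoint)
  qed (simp_all add: deg_inner_def algebra_simps sum.distrib sum_distrib_left)
  have fin: "finite B"
    using bound B(1,2) by simp
  have card: "card B = card V"
    using vx.dim_eq_card[of B E] vx.dim_eq_card[of E E] B E by simp
  have "\<exists>a::real. avg b = (\<lambda>v. of_real a * b v) \<and> \<bar>a\<bar> \<le> 1" if b: "b \<in> B" for b
  proof -
    obtain a where a: "avg b = (\<lambda>v. a * b v)"
      using B b by blast
    have b0: "b \<noteq> 0" "b \<in> vertex_functions"
      using B b vx.dependent_zero by auto
    \<comment> \<open>Moving \<open>avg\<close> across the inner product of \<open>b\<close> with
      itself forces the eigenvalue to be real.\<close>
    have "a * deg_inner b b = cnj a * deg_inner b b"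
      using avg_self_adjoint[of b b] unfolding a
      by (simp add: deg_inner_def sum_distrib_left mult_ac)
    moreover have "deg_inner b b \<noteq> 0"
      using deg_norm_pos[OF b0(2,1)] unfolding deg_inner_self of_real_eq_0_iff by simp
    ultimately have "a = cnj a" by simp
    then have a_real: "a = of_real (Re a)"
      by (simp add: complex_eq_iff)
    then have "b \<in> avg_eigenspace (Re a)"
      using a b0 by (simp add: avg_eigenspace_def)
    then show ?thesis
      using avg_eigenvalue_abs_le_1 b0 by (auto simp: avg_eigenspace_def)
  qed
  then obtain \<alpha> :: "('v \<Rightarrow> complex) \<Rightarrow> real"
    where \<alpha>: "\<And>b. b \<in> B \<Longrightarrow> avg b = (\<lambda>v. of_real (\<alpha> b) * b v)" "\<And>b. b \<in> B \<Longrightarrow> \<bar>\<alpha> b\<bar> \<le> 1"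
    by metis
  have "vx.span {b \<in> B. \<alpha> b = a} = avg_eigenspace a" for a
    using vx.eigenspace_basis[OF fin B(2) \<alpha>(1), of "of_real a"] B(3)
    by (simp add: avg_eigenspace_def)
  then show ?thesis
    by (intro that[of B \<alpha>, OF fin card B(2)]) (simp_all add: \<alpha>(2))
qed

text \<open>Of the \<open>card V\<close> vectors of an eigenbasis exactly two have an eigenvalue of
  modulus 1: one for \<open>1\<close>, belonging to the constants, and one for \<open>-1\<close>,
  belonging to the bipartition sign.\<close>

lemma interior_spectrum_count:
  assumes "graph_bipartite V D"
  shows "finite {a. \<bar>a\<bar> < 1 \<and> avg_eigenspace a \<noteq> {0}}"
    and "(\<Sum>a\<in>{a. \<bar>a\<bar> < 1 \<and> avg_eigenspace a \<noteq> {0}}. vx.dim (avg_eigenspace a)) = card V - 2"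
proof -
  obtain B \<alpha> where B: "finite B" "card B = card V" "vx.independent B"
    "\<forall>b\<in>B. \<bar>\<alpha> b\<bar> \<le> 1"
    "\<forall>a. vx.span {b \<in> B. \<alpha> b = a} = avg_eigenspace a"
    by (rule avg_spectral_decomposition)
  have indep: "vx.independent {b \<in> B. \<alpha> b = a}" for a
    using B(3) by (rule vx.independent_mono) auto
  have dim: "vx.dim (avg_eigenspace a) = card {b \<in> B. \<alpha> b = a}" for a
    unfolding B(5)[rule_format, symmetric] using indep by (rule vx.dim_span_eq_card_independent)
  have triv: "avg_eigenspace a \<noteq> {0} \<longleftrightarrow> (\<exists>b\<in>B. \<alpha> b = a)" for a
  proof
    assume "avg_eigenspace a \<noteq> {0}"
    then have "{b \<in> B. \<alpha> b = a} \<noteq> {}"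
      unfolding B(5)[rule_format, symmetric] by (metis vx.span_empty)
    then show "\<exists>b\<in>B. \<alpha> b = a" by auto
  next
    assume "\<exists>b\<in>B. \<alpha> b = a"
    then obtain b where "b \<in> B" "\<alpha> b = a" by blast
    then have "b \<in> avg_eigenspace a" "b \<noteq> 0"
      unfolding B(5)[rule_format, symmetric] using B(3) vx.dependent_zero by (auto intro: vx.span_base)
    then show "avg_eigenspace a \<noteq> {0}" by auto
  qed
  have dim1: "vx.dim (avg_eigenspace s) = 1"
    if "s\<^sup>2 = 1" "\<eta> \<in> vertex_functions" "\<And>v. v \<in> V \<Longrightarrow> \<eta> v = 1 \<or> \<eta> v = -1"
      "\<And>v w. w \<in> nbrs v \<Longrightarrow> \<eta> v = of_real s * \<eta> w" for s \<eta>
  proof -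
    obtain r where "r \<in> V"
      using V_nonempty by auto
    then have "\<eta> \<noteq> 0" using that(3) by force
    then have "vx.independent {\<eta>}" by simp
    then show ?thesis
      using extremal_eigenspace[of s \<eta>] that vx.dim_span_eq_card_independent[of "{\<eta>}"] by simp
  qed
  have in_V: "v \<in> V" if "w \<in> nbrs v" for v w
    using that nbrs_subset nbrs_sym by blast
  have plus: "vx.dim (avg_eigenspace 1) = 1"
    by (rule dim1[of _ "\<lambda>v. if v \<in> V then 1 else 0"])
      (auto simp: vertex_functions_def dest: in_V subsetD[OF nbrs_subset])
  obtain c :: "'v \<Rightarrow> bool" where c: "\<And>u w. adj D u w \<Longrightarrow> c u \<noteq> c w"
    using assms by (auto simp: graph_bipartite_def)
  \<comment> \<open>The witness is the sign of the colour class, which flips across every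
    edge.\<close>
  have minus: "vx.dim (avg_eigenspace (-1)) = 1"
  proof (rule dim1[of _ "\<lambda>v. if v \<in> V then if c v then 1 else -1 else 0"])
    fix v w assume w: "w \<in> nbrs v"
    then have "v \<in> V" "w \<in> V" "c v \<noteq> c w"
      using in_V nbrs_subset c by (auto simp: nbrs_def)
    then show "(if v \<in> V then if c v then 1 else -1 else 0) =
        complex_of_real (-1) * (if w \<in> V then if c w then 1 else -1 else 0)"
      by auto
  qed (auto simp: vertex_functions_def)
  let ?A = "{a. \<bar>a\<bar> < 1 \<and> avg_eigenspace a \<noteq> {0}}"
  have A: "?A = \<alpha> ` {b \<in> B. \<bar>\<alpha> b\<bar> < 1}"
    using triv by auto
  then show fin: "finite ?A"
    using B(1) by simp
  \<comment> \<open>Dimensions are sizes of fibres of \<open>\<alpha>\<close>, and the fibres over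
    \<open>?A\<close> partition the basis vectors with interior eigenvalue.\<close>
  have "(\<Sum>a\<in>?A. vx.dim (avg_eigenspace a)) = (\<Sum>a\<in>?A. card {b \<in> {b \<in> B. \<bar>\<alpha> b\<bar> < 1}. \<alpha> b = a})"
    unfolding dim by (intro sum.cong refl arg_cong[where f = card]) auto
  also have "\<dots> = card {b \<in> B. \<bar>\<alpha> b\<bar> < 1}"
    unfolding A using B(1)
    by (subst card_UN_disjoint[symmetric]) (auto intro!: arg_cong[where f = card])
  also have "\<dots> = card V - 2"
  proof -
    have "B = {b \<in> B. \<bar>\<alpha> b\<bar> < 1} \<union> ({b \<in> B. \<alpha> b = 1} \<union> {b \<in> B. \<alpha> b = -1})"
      using B(4) by fastforce
    then have "card B = card ({b \<in> B. \<bar>\<alpha> b\<bar> < 1} \<union> ({b \<in> B. \<alpha> b = 1} \<union> {b \<in> B. \<alpha> b = -1}))"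
      by simp
    also have "\<dots> = card {b \<in> B. \<bar>\<alpha> b\<bar> < 1} + card ({b \<in> B. \<alpha> b = 1} \<union> {b \<in> B. \<alpha> b = -1})"
      using B(1) by (intro card_Un_disjoint) auto
    also have "card ({b \<in> B. \<alpha> b = 1} \<union> {b \<in> B. \<alpha> b = -1}) = 1 + 1"
      using B(1) plus minus unfolding dim by (subst card_Un_disjoint) auto
    finally show ?thesis using B(2) by simp
  qed
  finally show "(\<Sum>a\<in>?A. vx.dim (avg_eigenspace a)) = card V - 2" .
qed

end

section \<open>Solutions on edges\<close>

text \<open>For \<open>sin \<omega> \<noteq> 0\<close> this is the solution of f'' = - \<omega>^2 f
  with boundary values \<open>p\<close> at 0 and \<open>q\<close> at 1. In this form, reversing the
  edge merely exchanges \<open>p\<close> and \<open>q\<close>.\<close>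

definition edge_sol :: "real \<Rightarrow> complex \<Rightarrow> complex \<Rightarrow> real \<Rightarrow> complex" where
  "edge_sol \<omega> p q x =
     (p * of_real (sin (\<omega> * (1 - x))) + q * of_real (sin (\<omega> * x))) / of_real (sin \<omega>)"

definition edge_sol_deriv :: "real \<Rightarrow> complex \<Rightarrow> complex \<Rightarrow> real \<Rightarrow> complex" where
  "edge_sol_deriv \<omega> p q x =
     of_real \<omega> * (q * of_real (cos (\<omega> * x)) - p * of_real (cos (\<omega> * (1 - x)))) / of_real (sin \<omega>)"

lemma has_vector_derivative_edge_sol:
  "(edge_sol \<omega> p q has_vector_derivative edge_sol_deriv \<omega> p q x) (at x within S)"
proof -
  have s1: "((\<lambda>x. complex_of_real (sin (\<omega> * (1 - x)))) has_vector_derivative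
      of_real (- \<omega> * cos (\<omega> * (1 - x)))) (at x within S)"
    by (rule has_vector_derivative_of_real) (auto intro!: derivative_eq_intros)
  have s2: "((\<lambda>x. complex_of_real (sin (\<omega> * x))) has_vector_derivative
      of_real (\<omega> * cos (\<omega> * x))) (at x within S)"
    by (rule has_vector_derivative_of_real) (auto intro!: derivative_eq_intros)
  have "((\<lambda>x. (p * of_real (sin (\<omega> * (1 - x))) + q * of_real (sin (\<omega> * x))) / of_real (sin \<omega>))
      has_vector_derivative (p * of_real (- \<omega> * cos (\<omega> * (1 - x))) + q * of_real (\<omega> * cos (\<omega> * x)))
        / of_real (sin \<omega>)) (at x within S)"
    by (intro has_vector_derivative_divide has_vector_derivative_add has_vector_derivative_mult_right s1 s2)
  then show ?thesis
    unfolding edge_sol_def[abs_def] edge_sol_deriv_def by (simp add: algebra_simps)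
qed

lemma has_vector_derivative_edge_sol_deriv:
  "(edge_sol_deriv \<omega> p q has_vector_derivative - (of_real (\<omega>\<^sup>2) * edge_sol \<omega> p q x)) (at x within S)"
proof -
  have c1: "((\<lambda>x. complex_of_real (cos (\<omega> * (1 - x)))) has_vector_derivative
      of_real (\<omega> * sin (\<omega> * (1 - x)))) (at x within S)"
    by (rule has_vector_derivative_of_real) (auto intro!: derivative_eq_intros)
  have c2: "((\<lambda>x. complex_of_real (cos (\<omega> * x))) has_vector_derivative
      of_real (- \<omega> * sin (\<omega> * x))) (at x within S)"
    by (rule has_vector_derivative_of_real) (auto intro!: derivative_eq_intros)
  have "((\<lambda>x. of_real \<omega> * (q * of_real (cos (\<omega> * x)) - p * of_real (cos (\<omega> * (1 - x)))) / of_real (sin \<omega>))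
      has_vector_derivative of_real \<omega> * (q * of_real (- \<omega> * sin (\<omega> * x)) - p * of_real (\<omega> * sin (\<omega> * (1 - x))))
        / of_real (sin \<omega>)) (at x within S)"
    by (intro has_vector_derivative_divide has_vector_derivative_diff has_vector_derivative_mult_right c1 c2)
  moreover have "of_real \<omega> * (q * of_real (- \<omega> * sin (\<omega> * x)) - p * of_real (\<omega> * sin (\<omega> * (1 - x))))
        / of_real (sin \<omega>) = - (of_real (\<omega>\<^sup>2) * edge_sol \<omega> p q x)"
    by (simp add: edge_sol_def power2_eq_square algebra_simps add_divide_distrib diff_divide_distrib)
  ultimately show ?thesis
    unfolding edge_sol_deriv_def[abs_def] by simp
qed

lemma edge_sol_ends:
  assumes "sin \<omega> \<noteq> 0"
  shows "edge_sol \<omega> p q 0 = p" "edge_sol \<omega> p q 1 = q"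
  using assms by (simp_all add: edge_sol_def)

text \<open>The derivative pointing into the edge has the same form at both ends: the far value
  minus \<open>cos \<omega>\<close> times the near value, up to a common factor. The orientation of
  an edge thus disappears from the Kirchhoff sum.\<close>

lemma edge_sol_deriv_ends:
  "edge_sol_deriv \<omega> p q 0 = of_real (\<omega> / sin \<omega>) * (q - of_real (cos \<omega>) * p)"
  "- edge_sol_deriv \<omega> p q 1 = of_real (\<omega> / sin \<omega>) * (p - of_real (cos \<omega>) * q)"
  by (simp_all add: edge_sol_deriv_def algebra_simps add_divide_distrib diff_divide_distrib)

text \<open>The rotated pair \<open>(f cos - (f'/\<omega>) sin, f sin + (f'/\<omega>) cos)\<close> is conserved along
  solutions of \<open>f'' = - \<omega>\<^sup>2 f\<close>.\<close>

lemma oscillator_solution: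
  fixes f f' :: "real \<Rightarrow> complex"
  assumes f: "\<And>x. x \<in> {0..1} \<Longrightarrow> (f has_vector_derivative f' x) (at x within {0..1})"
    and f': "\<And>x. x \<in> {0..1} \<Longrightarrow> (f' has_vector_derivative - (of_real (\<omega>\<^sup>2) * f x)) (at x within {0..1})"
    and "\<omega> \<noteq> 0" "x \<in> {0..1}"
  shows "f x = f 0 * of_real (cos (\<omega> * x)) + f' 0 / of_real \<omega> * of_real (sin (\<omega> * x))"
proof -
  let ?C = "\<lambda>x. complex_of_real (cos (\<omega> * x))" and ?S = "\<lambda>x. complex_of_real (sin (\<omega> * x))"
  have C: "(?C has_vector_derivative of_real (- \<omega> * sin (\<omega> * x))) (at x within {0..1})" for x
    by (rule has_vector_derivative_of_real) (auto intro!: derivative_eq_intros)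
  have S: "(?S has_vector_derivative of_real (\<omega> * cos (\<omega> * x))) (at x within {0..1})" for x
    by (rule has_vector_derivative_of_real) (auto intro!: derivative_eq_intros)
  obtain c where c: "\<And>x. x \<in> {0..1} \<Longrightarrow> f x * ?C x - f' x / of_real \<omega> * ?S x = c"
  proof (rule has_vector_derivative_zero_constant)
    fix x :: real assume x: "x \<in> {0..1}"
    have "((\<lambda>x. f x * ?C x - f' x / of_real \<omega> * ?S x) has_vector_derivative
        (f x * of_real (- \<omega> * sin (\<omega> * x)) + f' x * ?C x)
        - (f' x / of_real \<omega> * of_real (\<omega> * cos (\<omega> * x)) + - (of_real (\<omega>\<^sup>2) * f x) / of_real \<omega> * ?S x))
        (at x within {0..1})"
      by (intro has_vector_derivative_diff has_vector_derivative_mult has_vector_derivative_divide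
          f[OF x] f'[OF x] C S)
    then show "((\<lambda>x. f x * ?C x - f' x / of_real \<omega> * ?S x) has_vector_derivative 0) (at x within {0..1})"
      by (rule has_vector_derivative_eq_rhs)
        (use assms(3) in \<open>simp add: power2_eq_square field_simps\<close>)
  next
    fix c assume "\<And>x. x \<in> {0..1} \<Longrightarrow> f x * ?C x - f' x / of_real \<omega> * ?S x = c"
    then show thesis by (rule that)
  qed (rule convex_real_interval)
  obtain d where d: "\<And>x. x \<in> {0..1} \<Longrightarrow> f x * ?S x + f' x / of_real \<omega> * ?C x = d"
  proof (rule has_vector_derivative_zero_constant)
    fix x :: real assume x: "x \<in> {0..1}"
    have "((\<lambda>x. f x * ?S x + f' x / of_real \<omega> * ?C x) has_vector_derivative
        (f x * of_real (\<omega> * cos (\<omega> * x)) + f' x * ?S x)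
        + (f' x / of_real \<omega> * of_real (- \<omega> * sin (\<omega> * x)) + - (of_real (\<omega>\<^sup>2) * f x) / of_real \<omega> * ?C x))
        (at x within {0..1})"
      by (intro has_vector_derivative_add has_vector_derivative_mult has_vector_derivative_divide
          f[OF x] f'[OF x] C S)
    then show "((\<lambda>x. f x * ?S x + f' x / of_real \<omega> * ?C x) has_vector_derivative 0) (at x within {0..1})"
      by (rule has_vector_derivative_eq_rhs)
        (use assms(3) in \<open>simp add: power2_eq_square field_simps\<close>)
  next
    fix c assume "\<And>x. x \<in> {0..1} \<Longrightarrow> f x * ?S x + f' x / of_real \<omega> * ?C x = c"
    then show thesis by (rule that)
  qed (rule convex_real_interval)
  have cd: "c = f 0" "d = f' 0 / of_real \<omega>"
    using c[of 0] d[of 0] by auto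
  have "?C x * ?C x + ?S x * ?S x = of_real ((cos (\<omega> * x))\<^sup>2 + (sin (\<omega> * x))\<^sup>2)"
    by (simp only: power2_eq_square of_real_add of_real_mult)
  also have "\<dots> = 1"
    by (simp only: sin_cos_squared_add2 of_real_1)
  finally have one: "?C x * ?C x + ?S x * ?S x = 1" .
  \<comment> \<open>The inverse rotation applied to the conserved pair recovers
    \<open>f x\<close>.\<close>
  have "f x = f x * (?C x * ?C x + ?S x * ?S x)"
    unfolding one by simp
  also have "\<dots> = (f x * ?C x - f' x / of_real \<omega> * ?S x) * ?C x
      + (f x * ?S x + f' x / of_real \<omega> * ?C x) * ?S x"
    by (simp add: algebra_simps)
  finally show ?thesis
    unfolding c[OF assms(4)] d[OF assms(4)] cd .
qed

text \<open>The initial value formula at 1 expresses \<open>f 1\<close> through \<open>f 0\<close>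
  and \<open>f' 0\<close>; the subtraction formula for the sine then turns initial data into
  boundary data.\<close>

lemma oscillator_eq_edge_sol:
  fixes f f' :: "real \<Rightarrow> complex"
  assumes f: "\<And>x. x \<in> {0..1} \<Longrightarrow> (f has_vector_derivative f' x) (at x within {0..1})"
    and f': "\<And>x. x \<in> {0..1} \<Longrightarrow> (f' has_vector_derivative - (of_real (\<omega>\<^sup>2) * f x)) (at x within {0..1})"
    and "sin \<omega> \<noteq> 0" "x \<in> {0..1}"
  shows "f x = edge_sol \<omega> (f 0) (f 1) x" "f' x = edge_sol_deriv \<omega> (f 0) (f 1) x"
proof -
  have \<omega>: "\<omega> \<noteq> 0" using assms(3) by auto
  have sol: "f x = f 0 * of_real (cos (\<omega> * x)) + f' 0 / of_real \<omega> * of_real (sin (\<omega> * x))"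
    if "x \<in> {0..1}" for x
    by (rule oscillator_solution) (fact f, fact f', fact \<omega>, fact that)
  have f1: "f 1 = f 0 * of_real (cos \<omega>) + f' 0 / of_real \<omega> * of_real (sin \<omega>)"
    using sol[of 1] by simp
  have eq: "f x = edge_sol \<omega> (f 0) (f 1) x" if "x \<in> {0..1}" for x
  proof -
    have "edge_sol \<omega> (f 0) (f 1) x * of_real (sin \<omega>) =
        f 0 * of_real (sin (\<omega> - \<omega> * x)) + f 1 * of_real (sin (\<omega> * x))"
      using assms(3) by (simp add: edge_sol_def right_diff_distrib)
    also have "\<dots> = (f 0 * of_real (cos (\<omega> * x)) + f' 0 / of_real \<omega> * of_real (sin (\<omega> * x))) * of_real (sin \<omega>)"
      unfolding f1 sin_diff by (simp add: algebra_simps)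
    also have "\<dots> = f x * of_real (sin \<omega>)"
      using sol[of x] that by simp
    finally show ?thesis using assms(3) by simp
  qed
  show "f x = edge_sol \<omega> (f 0) (f 1) x"
    using assms(4) by (rule eq)
  \<comment> \<open>Since \<open>f\<close> agrees with the explicit solution on the whole interval,
    uniqueness of derivatives, one-sided at the ends, identifies \<open>f'\<close> as well.\<close>
  have "(f has_vector_derivative edge_sol_deriv \<omega> (f 0) (f 1) x) (at x within {0..1})"
    using has_vector_derivative_edge_sol
    by (rule has_vector_derivative_transform[OF assms(4), rotated]) (rule eq)
  then show "f' x = edge_sol_deriv \<omega> (f 0) (f 1) x"
    using vector_derivative_unique_within_closed_interval[of 0 1 x f "f' x"] f[OF assms(4)] assms(4)
    by (simp add: cbox_interval)
qed

section \<open>Correspondence between eigenfunctions and vertex functions\<close>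

context connected_graph
begin

text \<open>The value 0 off the edges and outside the unit interval follows the convention of
  \<open>qg_eigfun\<close>, so that equality of functions is literal.\<close>

definition edge_extension :: "real \<Rightarrow> ('v \<Rightarrow> complex) \<Rightarrow> 'v \<times> 'v \<Rightarrow> real \<Rightarrow> complex" where
  "edge_extension \<omega> \<phi> e x =
     (if e \<in> D \<and> x \<in> {0..1} then edge_sol \<omega> (\<phi> (fst e)) (\<phi> (snd e)) x else 0)"

text \<open>No edge occurs together with its reverse, so heads of outgoing and tails of incoming
  edges are disjoint.\<close>

lemma sum_nbrs_split:
  fixes F :: "'v \<Rightarrow> complex"
  shows "(\<Sum>w\<in>nbrs v. F w) = (\<Sum>w\<in>{w. (v, w) \<in> D}. F w) + (\<Sum>u\<in>{u. (u, v) \<in> D}. F u)"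
proof -
  have eq: "nbrs v = {w. (v, w) \<in> D} \<union> {u. (u, v) \<in> D}"
    by (auto simp: nbrs_def adj_def)
  have "finite {w. (v, w) \<in> D}" "finite {u. (u, v) \<in> D}"
    using finite_nbrs[of v] unfolding eq by auto
  moreover have "{w. (v, w) \<in> D} \<inter> {u. (u, v) \<in> D} = {}"
    using simple by (auto simp: simple_oriented_graph_def)
  ultimately show ?thesis
    unfolding eq by (rule sum.union_disjoint)
qed

text \<open>With both end derivatives in the same form, outgoing and incoming edges merge into one
  sum over neighbours, which is the defect in the averaging equation for
  \<open>cos \<omega>\<close>.\<close>

lemma kirchhoff_sum:
  "(\<Sum>w\<in>{w. (v, w) \<in> D}. edge_sol_deriv \<omega> (\<phi> v) (\<phi> w) 0)
    + (\<Sum>u\<in>{u. (u, v) \<in> D}. - edge_sol_deriv \<omega> (\<phi> u) (\<phi> v) 1)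
   = of_real (\<omega> / sin \<omega>) * ((\<Sum>w\<in>nbrs v. \<phi> w) - of_real (cos \<omega>) * of_nat (card (nbrs v)) * \<phi> v)"
proof -
  have "(\<Sum>w\<in>nbrs v. of_real (\<omega> / sin \<omega>) * (\<phi> w - of_real (cos \<omega>) * \<phi> v))
    = of_real (\<omega> / sin \<omega>) * ((\<Sum>w\<in>nbrs v. \<phi> w) - of_real (cos \<omega>) * of_nat (card (nbrs v)) * \<phi> v)"
    unfolding sum_distrib_left[symmetric] sum_subtractf by simp
  then show ?thesis
    unfolding edge_sol_deriv_ends sum_nbrs_split[symmetric] .
qed

lemma edge_extension_eigfun:
  assumes "sin \<omega> \<noteq> 0" "\<phi> \<in> avg_eigenspace (cos \<omega>)"
  shows "qg_eigfun V D (\<omega>\<^sup>2) (edge_extension \<omega> \<phi>)"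
proof -
  let ?f = "edge_extension \<omega> \<phi>"
  define f' where "f' e x = edge_sol_deriv \<omega> (\<phi> (fst e)) (\<phi> (snd e)) x" for e x
  \<comment> \<open>The classical second derivative: it is continuous and satisfies the equation at
    every point, so the exceptional set is empty.\<close>
  define g where "g e x = - (of_real (\<omega>\<^sup>2) * edge_sol \<omega> (\<phi> (fst e)) (\<phi> (snd e)) x)" for e x
  have ends: "?f (u, w) 0 = \<phi> u" "?f (u, w) 1 = \<phi> w" if "(u, w) \<in> D" for u w
    using that assms(1) by (simp_all add: edge_extension_def edge_sol_ends)
  have cont_sol: "continuous_on S (edge_sol \<omega> p q)" for S p q
    by (rule continuous_on_vector_derivative) (rule has_vector_derivative_edge_sol)
  have cont_g: "continuous_on S (g e)" for S e
    unfolding g_def[abs_def] by (intro continuous_intros cont_sol)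
  have edge: "(\<forall>x\<in>{0..1}. (?f e has_vector_derivative f' e x) (at x within {0..1})) \<and>
           continuous_on {0..1} (f' e) \<and>
           g e absolutely_integrable_on {0..1} \<and>
           (\<lambda>x. (norm (g e x))\<^sup>2) integrable_on {0..1} \<and>
           (\<forall>x\<in>{0..1}. f' e x = f' e 0 + integral {0..x} (g e)) \<and>
           negligible {x \<in> {0..1}. - g e x \<noteq> complex_of_real (\<omega>\<^sup>2) * ?f e x}"
    if e: "e \<in> D" for e
  proof (intro conjI ballI)
    fix x :: real assume x: "x \<in> {0..1}"
    show "(?f e has_vector_derivative f' e x) (at x within {0..1})"
      unfolding f'_def using has_vector_derivative_edge_sol
      by (rule has_vector_derivative_transform[OF x, rotated]) (use e in \<open>simp add: edge_extension_def\<close>)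
    have "(g e has_integral f' e x - f' e 0) {0..x}"
      using x unfolding g_def f'_def
      by (intro fundamental_theorem_of_calculus has_vector_derivative_edge_sol_deriv) auto
    then show "f' e x = f' e 0 + integral {0..x} (g e)"
      by (simp add: integral_unique)
  next
    show "continuous_on {0..1} (f' e)"
      unfolding f'_def[abs_def]
      by (rule continuous_on_vector_derivative) (rule has_vector_derivative_edge_sol_deriv)
    show "g e absolutely_integrable_on {0..1}"
      by (intro absolutely_integrable_continuous_real cont_g)
    show "(\<lambda>x. (norm (g e x))\<^sup>2) integrable_on {0..1}"
      by (intro integrable_continuous_real continuous_intros cont_g)
    have "{x \<in> {0..1}. - g e x \<noteq> complex_of_real (\<omega>\<^sup>2) * ?f e x} = {}"
      using e by (auto simp: g_def edge_extension_def)
    then show "negligible {x \<in> {0..1}. - g e x \<noteq> complex_of_real (\<omega>\<^sup>2) * ?f e x}"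
      by (metis negligible_empty)
  qed
  have kirchhoff: "(\<Sum>w\<in>{w. (v, w) \<in> D}. f' (v, w) 0) + (\<Sum>u\<in>{u. (u, v) \<in> D}. - f' (u, v) 1) = 0"
    if "v \<in> V" for v
    using assms(2) that unfolding f'_def fst_conv snd_conv kirchhoff_sum avg_eigenspace_iff by simp
  show ?thesis
    unfolding qg_eigfun_def
  proof (intro conjI, goal_cases)
    case 4
    show ?case
      by (rule exI[of _ f'], rule exI[of _ g], rule conjI; rule ballI; erule edge kirchhoff)
  next
    case 3
    show ?case by (auto simp: ends)
  qed (auto simp: edge_extension_def)
qed

text \<open>A regularity argument: almost everywhere \<open>g\<close> equals the continuous function
  - \<omega>^2 f, so \<open>f'\<close> is classically differentiable and each edge carries the
  explicit solution. Its end values give \<open>\<phi>\<close>, and the Kirchhoff condition gives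
  the averaging equation.\<close>

lemma eigfun_edge_extension:
  assumes "sin \<omega> \<noteq> 0" "qg_eigfun V D (\<omega>\<^sup>2) f"
  obtains \<phi> where "\<phi> \<in> avg_eigenspace (cos \<omega>)" "f = edge_extension \<omega> \<phi>"
proof -
  note F = assms(2)[unfolded qg_eigfun_def]
  have zero: "\<forall>e. e \<notin> D \<longrightarrow> (\<forall>x. f e x = 0)" "\<forall>e x. x \<notin> {0..1} \<longrightarrow> f e x = 0"
    using F[THEN conjunct1] F[THEN conjunct2, THEN conjunct1] .
  have vertex: "\<forall>u w u' w'. (u, w) \<in> D \<longrightarrow> (u', w') \<in> D \<longrightarrow>
        (u = u' \<longrightarrow> f (u, w) 0 = f (u', w') 0) \<and>
        (u = w' \<longrightarrow> f (u, w) 0 = f (u', w') 1) \<and>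
        (w = w' \<longrightarrow> f (u, w) 1 = f (u', w') 1)"
    using F[THEN conjunct2, THEN conjunct2, THEN conjunct1] .
  obtain f' g where edge_all: "\<forall>e\<in>D.
           (\<forall>x\<in>{0..1}. (f e has_vector_derivative f' e x) (at x within {0..1})) \<and>
           continuous_on {0..1} (f' e) \<and>
           g e absolutely_integrable_on {0..1} \<and>
           (\<lambda>x. (norm (g e x))\<^sup>2) integrable_on {0..1} \<and>
           (\<forall>x\<in>{0..1}. f' e x = f' e 0 + integral {0..x} (g e)) \<and>
           negligible {x \<in> {0..1}. - g e x \<noteq> complex_of_real (\<omega>\<^sup>2) * f e x}"
    and kirchhoff_all: "\<forall>v\<in>V.
        (\<Sum>w\<in>{w. (v, w) \<in> D}. f' (v, w) 0) + (\<Sum>u\<in>{u. (u, v) \<in> D}. - f' (u, v) 1) = 0"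
    using F[THEN conjunct2, THEN conjunct2, THEN conjunct2] by (elim exE conjE) (rule that)
  note edge = bspec[OF edge_all] and kirchhoff = bspec[OF kirchhoff_all]
  \<comment> \<open>The common value at \<open>v\<close> is read off an arbitrary outgoing edge, or
    an incoming one if there is none; continuity at the vertices makes the choice
    immaterial.\<close>
  define \<phi> where "\<phi> v = (if v \<in> V then
      if \<exists>w. (v, w) \<in> D then f (v, SOME w. (v, w) \<in> D) 0 else f (SOME u. (u, v) \<in> D, v) 1 else 0)" for v
  have \<phi>: "f (u, w) 0 = \<phi> u" "f (u, w) 1 = \<phi> w" if e: "(u, w) \<in> D" for u w
  proof -
    have V: "u \<in> V" "w \<in> V"
      using e simple by (auto simp: simple_oriented_graph_def)
    have out: "\<phi> v = f (v, SOME w. (v, w) \<in> D) 0 \<and> (v, SOME w. (v, w) \<in> D) \<in> D"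
      if "(v, w') \<in> D" "v \<in> V" for v w'
      using that by (auto simp: \<phi>_def intro: someI)
    show "f (u, w) 0 = \<phi> u"
      using out[OF e V(1)] vertex[rule_format, OF e conjunct2[OF out[OF e V(1)]]] by simp
    show "f (u, w) 1 = \<phi> w"
    proof (cases "\<exists>w'. (w, w') \<in> D")
      case True
      then obtain w' where "(w, w') \<in> D" ..
      note w' = out[OF this V(2)]
      show ?thesis
        using w' vertex[rule_format, OF conjunct2[OF w'] e] by simp
    next
      case False
      then have "\<phi> w = f (SOME u. (u, w) \<in> D, w) 1"
        using V(2) by (simp add: \<phi>_def)
      moreover have "(SOME u. (u, w) \<in> D, w) \<in> D"
        using e by (rule someI)
      note vertex[rule_format, OF e this]
      ultimately show ?thesis by simp
    qed
  qed
  have sol: "f e x = edge_sol \<omega> (f e 0) (f e 1) x \<and> f' e x = edge_sol_deriv \<omega> (f e 0) (f e 1) x"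
    if e: "e \<in> D" and x: "x \<in> {0..1}" for e x
  proof -
    have D1: "(f e has_vector_derivative f' e x) (at x within {0..1})" if "x \<in> {0..1}" for x
      using edge[OF e, THEN conjunct1] that by (rule bspec)
    have cont: "continuous_on {0..1} (f e)"
      by (rule continuous_on_vector_derivative) (rule D1)
    \<comment> \<open>Changing the integrand on a negligible set replaces \<open>g\<close> by a
      continuous function, to which the fundamental theorem applies at every point.\<close>
    have f'_eq: "f' e x = f' e 0 + integral {0..x} (\<lambda>x. - (of_real (\<omega>\<^sup>2) * f e x))"
      if "x \<in> {0..1}" for x
    proof -
      have "integral {0..x} (g e) = integral {0..x} (\<lambda>x. - (of_real (\<omega>\<^sup>2) * f e x))"
      proof (rule integral_spike)
        show "negligible {x \<in> {0..1}. - g e x \<noteq> complex_of_real (\<omega>\<^sup>2) * f e x}"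
          using edge[OF e] by (elim conjE)
        fix y assume "y \<in> {0..x} - {x \<in> {0..1}. - g e x \<noteq> complex_of_real (\<omega>\<^sup>2) * f e x}"
        then have "- g e y = complex_of_real (\<omega>\<^sup>2) * f e y"
          using \<open>x \<in> {0..1}\<close> by auto
        then show "- (of_real (\<omega>\<^sup>2) * f e y) = g e y"
          by (metis minus_minus)
      qed
      moreover have "f' e x = f' e 0 + integral {0..x} (g e)"
        using edge[OF e] that by (elim conjE) (rule bspec)
      ultimately show ?thesis by simp
    qed
    have D2: "(f' e has_vector_derivative - (of_real (\<omega>\<^sup>2) * f e x)) (at x within {0..1})"
      if x: "x \<in> {0..1}" for x
    proof -
      have "((\<lambda>x. f' e 0 + integral {0..x} (\<lambda>x. - (of_real (\<omega>\<^sup>2) * f e x))) has_vector_derivative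
          0 + - (of_real (\<omega>\<^sup>2) * f e x)) (at x within {0..1})"
        using x cont
        by (intro has_vector_derivative_add has_vector_derivative_const integral_has_vector_derivative
            continuous_intros) auto
      then have "((\<lambda>x. f' e 0 + integral {0..x} (\<lambda>x. - (of_real (\<omega>\<^sup>2) * f e x))) has_vector_derivative
          - (of_real (\<omega>\<^sup>2) * f e x)) (at x within {0..1})"
        by simp
      then show ?thesis
        by (rule has_vector_derivative_transform[OF x, rotated]) (rule f'_eq)
    qed
    show ?thesis
      by (intro conjI oscillator_eq_edge_sol) (fact D1 D2 assms(1) x)+
  qed
  have f_eq: "f = edge_extension \<omega> \<phi>"
  proof (intro ext)
    fix e x
    show "f e x = edge_extension \<omega> \<phi> e x"
    proof (cases "e \<in> D \<and> x \<in> {0..1}")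
      case True
      then have e: "(fst e, snd e) \<in> D" and x: "x \<in> {0..1}"
        by simp_all
      have "f e x = edge_sol \<omega> (f e 0) (f e 1) x"
        using sol[OF e x] unfolding prod.collapse by (rule conjunct1)
      then show ?thesis
        using \<phi>[OF e] unfolding prod.collapse edge_extension_def if_P[OF True] by metis
    next
      case False
      then have "f e x = 0"
        using zero(1)[rule_format, of e x] zero(2)[rule_format, of x e] by blast
      then show ?thesis
        unfolding edge_extension_def if_not_P[OF False] .
    qed
  qed
  have f'_ends: "f' (u, w) x = edge_sol_deriv \<omega> (\<phi> u) (\<phi> w) x" if "(u, w) \<in> D" "x \<in> {0..1}" for u w x
    using sol[OF that] \<phi>[OF that(1)] by simp
  have "\<phi> \<in> avg_eigenspace (cos \<omega>)"
    unfolding avg_eigenspace_iff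
  proof (intro conjI ballI)
    show "\<phi> \<in> vertex_functions"
      by (simp add: vertex_functions_def \<phi>_def)
    fix v assume v: "v \<in> V"
    have "(\<Sum>w\<in>{w. (v, w) \<in> D}. edge_sol_deriv \<omega> (\<phi> v) (\<phi> w) 0)
      + (\<Sum>u\<in>{u. (u, v) \<in> D}. - edge_sol_deriv \<omega> (\<phi> u) (\<phi> v) 1) = 0"
      using kirchhoff[OF v] by (simp add: f'_ends)
    \<comment> \<open>The factor \<open>\<omega> / sin \<omega>\<close> is nonzero, since
      \<open>sin \<omega> \<noteq> 0\<close> also excludes \<open>\<omega> = 0\<close>.\<close>
    then have "(\<Sum>w\<in>nbrs v. \<phi> w) - of_real (cos \<omega>) * of_nat (card (nbrs v)) * \<phi> v = 0"
      unfolding kirchhoff_sum using assms(1) by auto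
    then show "(\<Sum>w\<in>nbrs v. \<phi> w) = of_real (cos \<omega>) * of_nat (card (nbrs v)) * \<phi> v"
      by simp
  qed
  then show ?thesis
    using f_eq by (rule that)
qed

lemma qg_eigenspace_eq_image:
  assumes "sin \<omega> \<noteq> 0"
  shows "qg_eigenspace V D (\<omega>\<^sup>2) = edge_extension \<omega> ` avg_eigenspace (cos \<omega>)"
proof
  show "qg_eigenspace V D (\<omega>\<^sup>2) \<subseteq> edge_extension \<omega> ` avg_eigenspace (cos \<omega>)"
  proof
    fix f assume "f \<in> qg_eigenspace V D (\<omega>\<^sup>2)"
    then have "qg_eigfun V D (\<omega>\<^sup>2) f" by (simp add: qg_eigenspace_def)
    then obtain \<phi> where "\<phi> \<in> avg_eigenspace (cos \<omega>)" "f = edge_extension \<omega> \<phi>"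
      by (rule eigfun_edge_extension[OF assms])
    then show "f \<in> edge_extension \<omega> ` avg_eigenspace (cos \<omega>)" by simp
  qed
next
  show "edge_extension \<omega> ` avg_eigenspace (cos \<omega>) \<subseteq> qg_eigenspace V D (\<omega>\<^sup>2)"
    using edge_extension_eigfun[OF assms] by (auto simp: qg_eigenspace_def)
qed

text \<open>Every vertex is an end of some edge, so its value can be read off there.\<close>

lemma edge_extension_inj:
  assumes "sin \<omega> \<noteq> 0"
  shows "inj_on (edge_extension \<omega>) vertex_functions"
proof (rule inj_onI, rule ext)
  fix \<phi> \<psi> v
  assume \<phi>: "\<phi> \<in> vertex_functions" and \<psi>: "\<psi> \<in> vertex_functions"
    and eq: "edge_extension \<omega> \<phi> = edge_extension \<omega> \<psi>"
  show "\<phi> v = \<psi> v"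
  proof (cases "v \<in> V")
    case True
    then obtain w where "adj D v w"
      using nbrs_nonempty by (auto simp: nbrs_def)
    then consider "(v, w) \<in> D" | "(w, v) \<in> D"
      by (auto simp: adj_def)
    then show ?thesis
    proof cases
      case 1
      then show ?thesis
        using fun_cong[OF fun_cong[OF eq], of "(v, w)" 0] assms
        by (simp add: edge_extension_def edge_sol_ends)
    next
      case 2
      then show ?thesis
        using fun_cong[OF fun_cong[OF eq], of "(w, v)" 1] assms
        by (simp add: edge_extension_def edge_sol_ends)
    qed
  next
    case False
    then show ?thesis using \<phi> \<psi> by (simp add: vertex_functions_def)
  qed
qed

lemma linear_edge_extension:
  "Vector_Spaces.linear (\<lambda>(c::complex) (\<phi>::'v \<Rightarrow> complex) v. c * \<phi> v)
     (\<lambda>(c::complex) (f::'v \<times> 'v \<Rightarrow> real \<Rightarrow> complex) e x. c * f e x) (edge_extension \<omega>)"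
  by unfold_locales
    (auto simp: fun_eq_iff edge_extension_def edge_sol_def algebra_simps add_divide_distrib)

text \<open>The extension map is linear and injective, so it carries a basis of the vertex
  eigenspace to a basis of the graph eigenspace.\<close>

lemma qg_mult_eq_dim:
  assumes "sin \<omega> \<noteq> 0"
  shows "qg_mult V D (\<omega>\<^sup>2) = vx.dim (avg_eigenspace (cos \<omega>))"
proof -
  interpret ext: Vector_Spaces.linear "\<lambda>(c::complex) (\<phi>::'v \<Rightarrow> complex) v. c * \<phi> v"
    "\<lambda>(c::complex) (f::'v \<times> 'v \<Rightarrow> real \<Rightarrow> complex) e x. c * f e x" "edge_extension \<omega>"
    by (rule linear_edge_extension)
  let ?E = "avg_eigenspace (cos \<omega>)"
  obtain B where B: "B \<subseteq> ?E" "vx.independent B" "?E \<subseteq> vx.span B" "card B = vx.dim ?E"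
    by (rule vx.basis_exists)
  have span: "vx.span B = ?E"
    using B(1,3) subspace_avg_eigenspace by (rule vx.span_subspace)
  have inj: "inj_on (edge_extension \<omega>) ?E"
    using edge_extension_inj[OF assms] by (rule inj_on_subset) (auto simp: avg_eigenspace_def)
  have "ext.vs2.independent (edge_extension \<omega> ` B)"
    using B(2) inj unfolding span[symmetric] by (rule ext.independent_injective_image)
  then have "ext.vs2.dim (ext.vs2.span (edge_extension \<omega> ` B)) = card (edge_extension \<omega> ` B)"
    by (rule ext.vs2.dim_span_eq_card_independent)
  also have "card (edge_extension \<omega> ` B) = card B"
    using inj B(1) by (intro card_image) (rule inj_on_subset)
  finally show ?thesis
    unfolding qg_mult_def qg_eigenspace_eq_image[OF assms] ext.span_image span B(4) .
qed

lemma qg_is_eigenvalue_iff: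
  assumes "sin \<omega> \<noteq> 0"
  shows "qg_is_eigenvalue V D (\<omega>\<^sup>2) \<longleftrightarrow> avg_eigenspace (cos \<omega>) \<noteq> {0}"
proof -
  have ext0: "edge_extension \<omega> 0 = 0"
    by (auto simp: fun_eq_iff edge_extension_def edge_sol_def)
  have sub: "avg_eigenspace (cos \<omega>) \<subseteq> vertex_functions" "{0} \<subseteq> vertex_functions"
    by (auto simp: avg_eigenspace_def vertex_functions_def)
  have "edge_extension \<omega> ` avg_eigenspace (cos \<omega>) = edge_extension \<omega> ` {0}
      \<longleftrightarrow> avg_eigenspace (cos \<omega>) = {0}"
    using edge_extension_inj[OF assms] sub by (rule inj_on_image_eq_iff)
  then show ?thesis
    unfolding qg_is_eigenvalue_def qg_eigenspace_eq_image[OF assms] by (simp add: ext0)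
qed

text \<open>Here \<open>\<theta>\<close> is a branch of the inverse cosine and \<open>P\<close> the
  band of squares of its values. The map from \<open>a\<close> to the square of
  \<open>\<theta> a\<close> is a bijection from the interior averaging spectrum to the eigenvalues
  in the band and preserves multiplicities. Stated for a general branch, it serves both
  bands.\<close>

lemma eigenvalue_count_branch:
  fixes \<theta> :: "real \<Rightarrow> real"
  assumes "graph_bipartite V D"
    and \<theta>: "\<forall>a. \<bar>a\<bar> < 1 \<longrightarrow> 0 < \<theta> a \<and> sin (\<theta> a) \<noteq> 0 \<and> cos (\<theta> a) = a"
    and P: "\<forall>lam. P lam \<longleftrightarrow> (\<exists>a. \<bar>a\<bar> < 1 \<and> lam = (\<theta> a)\<^sup>2)"
  shows "finite {lam. qg_is_eigenvalue V D lam \<and> P lam} \<and>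
    (\<Sum>lam\<in>{lam. qg_is_eigenvalue V D lam \<and> P lam}. qg_mult V D lam) = card V - 2"
proof -
  let ?A = "{a. \<bar>a\<bar> < 1 \<and> avg_eigenspace a \<noteq> {0}}"
  have pos: "0 < \<theta> a" and sin: "sin (\<theta> a) \<noteq> 0" and cos: "cos (\<theta> a) = a" if "\<bar>a\<bar> < 1" for a
    using \<theta>[rule_format, OF that] by simp_all
  have iff: "qg_is_eigenvalue V D ((\<theta> a)\<^sup>2) \<longleftrightarrow> avg_eigenspace a \<noteq> {0}" if "\<bar>a\<bar> < 1" for a
    using qg_is_eigenvalue_iff[OF sin[OF that]] cos[OF that] by simp
  have eq: "{lam. qg_is_eigenvalue V D lam \<and> P lam} = (\<lambda>a. (\<theta> a)\<^sup>2) ` ?A"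
  proof (intro equalityI subsetI)
    fix lam assume lam: "lam \<in> {lam. qg_is_eigenvalue V D lam \<and> P lam}"
    then obtain a where a: "\<bar>a\<bar> < 1" "lam = (\<theta> a)\<^sup>2"
      using P by blast
    show "lam \<in> (\<lambda>a. (\<theta> a)\<^sup>2) ` ?A"
      using a(2) by (rule image_eqI) (use lam a iff[OF a(1)] in simp)
  next
    fix lam assume "lam \<in> (\<lambda>a. (\<theta> a)\<^sup>2) ` ?A"
    then obtain a where a: "\<bar>a\<bar> < 1" "avg_eigenspace a \<noteq> {0}" "lam = (\<theta> a)\<^sup>2"
      by blast
    then have "P lam" using P by blast
    then show "lam \<in> {lam. qg_is_eigenvalue V D lam \<and> P lam}"
      using iff[OF a(1)] a(2,3) by simp
  qed
  \<comment> \<open>Positivity of \<open>\<theta>\<close> undoes the square, and the cosine undoes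
    \<open>\<theta>\<close>.\<close>
  have inj: "inj_on (\<lambda>a. (\<theta> a)\<^sup>2) ?A"
  proof (rule inj_onI)
    fix a b assume a: "a \<in> ?A" and b: "b \<in> ?A" and "(\<theta> a)\<^sup>2 = (\<theta> b)\<^sup>2"
    moreover have "0 < \<theta> a" "0 < \<theta> b"
      using a b pos by blast+
    ultimately have "\<theta> a = \<theta> b"
      by simp
    then show "a = b"
      using cos a b by (metis (no_types, lifting) mem_Collect_eq)
  qed
  have "(\<Sum>lam\<in>(\<lambda>a. (\<theta> a)\<^sup>2) ` ?A. qg_mult V D lam) = (\<Sum>a\<in>?A. vx.dim (avg_eigenspace a))"
    unfolding sum.reindex[OF inj] comp_def
  proof (rule sum.cong[OF refl])
    fix a assume "a \<in> ?A"
    then have "\<bar>a\<bar> < 1" by simp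
    then show "qg_mult V D ((\<theta> a)\<^sup>2) = vx.dim (avg_eigenspace a)"
      using qg_mult_eq_dim[OF sin[of a]] cos[of a] by simp
  qed
  then show ?thesis
    unfolding eq using interior_spectrum_count[OF assms(1)] by (intro conjI finite_imageI) simp_all
qed

end

section \<open>The two frequency bands and the inverse cosine\<close>

lemma arccos_interior:
  assumes "\<bar>a\<bar> < 1"
  shows "0 < arccos a" "arccos a < pi" "cos (arccos a) = a"
  using arccos_lt_bounded[of a] assms by (auto simp: abs_less_iff)

lemma abs_cos_less_1:
  fixes x :: real
  assumes "sin x \<noteq> 0"
  shows "\<bar>cos x\<bar> < 1"
proof -
  have "0 < (sin x)\<^sup>2" using assms by simp
  then have "(cos x)\<^sup>2 < 1"
    using sin_cos_squared_add[of x] by linarith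
  then show ?thesis by (simp add: abs_square_less_1)
qed

text \<open>The frequency \<open>sqrt lam\<close> ranges over (0, pi), onto which
  \<open>arccos\<close> maps (-1, 1).\<close>

lemma first_band_iff: "0 < lam \<and> lam < pi\<^sup>2 \<longleftrightarrow> (\<exists>a. \<bar>a\<bar> < 1 \<and> lam = (arccos a)\<^sup>2)"
proof
  assume lam: "0 < lam \<and> lam < pi\<^sup>2"
  then have "sqrt lam < sqrt (pi\<^sup>2)"
    by (simp only: real_sqrt_less_iff)
  then have "0 < sqrt lam" "sqrt lam < pi"
    using lam by simp_all
  moreover from this have "sin (sqrt lam) \<noteq> 0"
    using sin_gt_zero[of "sqrt lam"] by simp
  ultimately show "\<exists>a. \<bar>a\<bar> < 1 \<and> lam = (arccos a)\<^sup>2"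
    using lam abs_cos_less_1[of "sqrt lam"] by (intro exI[of _ "cos (sqrt lam)"]) (simp add: arccos_cos)
next
  assume "\<exists>a. \<bar>a\<bar> < 1 \<and> lam = (arccos a)\<^sup>2"
  then obtain a where "\<bar>a\<bar> < 1" and lam: "lam = (arccos a)\<^sup>2"
    by blast
  note a = arccos_interior[OF this(1)]
  then show "0 < lam \<and> lam < pi\<^sup>2"
    unfolding lam by (auto intro!: power_strict_mono)
qed

lemma second_band_iff:
  "pi\<^sup>2 < lam \<and> lam < (2 * pi)\<^sup>2 \<longleftrightarrow> (\<exists>a. \<bar>a\<bar> < 1 \<and> lam = (2 * pi - arccos a)\<^sup>2)"
proof
  assume lam: "pi\<^sup>2 < lam \<and> lam < (2 * pi)\<^sup>2"
  then have pos: "0 < lam"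
    using pi_gt_zero zero_le_power2[of pi] by linarith
  have bounds: "pi < sqrt lam" "sqrt lam < 2 * pi"
    using lam by (auto intro!: real_less_rsqrt real_less_lsqrt)
  \<comment> \<open>Reflection moves the frequency from (pi, 2 pi) into (0, pi), where
    \<open>arccos\<close> inverts the cosine.\<close>
  let ?\<omega> = "2 * pi - sqrt lam"
  have "sin ?\<omega> \<noteq> 0"
    using sin_gt_zero[of ?\<omega>] bounds by simp
  moreover have "(2 * pi - arccos (cos ?\<omega>))\<^sup>2 = lam"
    using bounds pos by (subst arccos_cos) auto
  ultimately show "\<exists>a. \<bar>a\<bar> < 1 \<and> lam = (2 * pi - arccos a)\<^sup>2"
    by (intro exI[of _ "cos ?\<omega>"]) (metis abs_cos_less_1)
next
  assume "\<exists>a. \<bar>a\<bar> < 1 \<and> lam = (2 * pi - arccos a)\<^sup>2"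
  then obtain a where "\<bar>a\<bar> < 1" and lam: "lam = (2 * pi - arccos a)\<^sup>2"
    by blast
  note a = arccos_interior[OF this(1)]
  then show "pi\<^sup>2 < lam \<and> lam < (2 * pi)\<^sup>2"
    unfolding lam by (intro conjI power_strict_mono) auto
qed

text \<open>Eigenfunctions vanish off the edges by convention, so without edges only the zero
  function remains.\<close>

lemma no_eigenvalue_without_edges: "\<not> qg_is_eigenvalue V {} lam"
  by (auto simp: qg_is_eigenvalue_def qg_eigenspace_def qg_eigfun_def fun_eq_iff)

theorem theorem2p4:
  fixes V :: "'v set" and D :: "('v \<times> 'v) set"
  assumes "simple_oriented_graph V D"
    and "graph_connected V D"
    and "graph_bipartite V D"
  shows "(finite {lam. qg_is_eigenvalue V D lam \<and> 0 < lam \<and> lam < pi\<^sup>2} \<and>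
         (\<Sum>lam\<in>{lam. qg_is_eigenvalue V D lam \<and> 0 < lam \<and> lam < pi\<^sup>2}. qg_mult V D lam)
           = card V - 2) \<and>
        (finite {lam. qg_is_eigenvalue V D lam \<and> pi\<^sup>2 < lam \<and> lam < (2 * pi)\<^sup>2} \<and>
         (\<Sum>lam\<in>{lam. qg_is_eigenvalue V D lam \<and> pi\<^sup>2 < lam \<and> lam < (2 * pi)\<^sup>2}. qg_mult V D lam)
           = card V - 2 \<and>
         (\<forall>lam. qg_is_eigenvalue V D lam \<and> pi\<^sup>2 < lam \<and> lam < (2 * pi)\<^sup>2 \<longrightarrow>
            (\<exists>mu. qg_is_eigenvalue V D mu \<and> 0 < mu \<and> mu < pi\<^sup>2 \<and>
                  lam = (2 * pi - sqrt mu)\<^sup>2 \<and> qg_mult V D lam = qg_mult V D mu)))"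
proof (cases "2 \<le> card V")
  case False
  have "D = {}"
  proof (rule ccontr)
    assume "D \<noteq> {}"
    then obtain u w where "(u, w) \<in> D" by auto
    then have "{u, w} \<subseteq> V" "u \<noteq> w" "finite V"
      using assms(1) by (auto simp: simple_oriented_graph_def)
    then have "card {u, w} \<le> card V"
      by (intro card_mono)
    with \<open>u \<noteq> w\<close> False show False by simp
  qed
  \<comment> \<open>Truncated subtraction makes \<open>card V - 2\<close> zero here, in agreement
    with the empty sums.\<close>
  then show ?thesis
    using False by (simp add: no_eigenvalue_without_edges)
next
  case True
  interpret connected_graph V D
    using assms(1,2) True by unfold_locales
  have sin1: "sin (arccos a) \<noteq> 0" if "\<bar>a\<bar> < 1" for a
    using arccos_interior[OF that] sin_gt_zero[of "arccos a"] by simp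
  have sin2: "sin (2 * pi - arccos a) \<noteq> 0" if "\<bar>a\<bar> < 1" for a
    using sin1[OF that] by (simp add: sin_diff)
  have cos2: "cos (2 * pi - arccos a) = a" if "\<bar>a\<bar> < 1" for a
    using arccos_interior[OF that] by (simp add: cos_diff)
  have "\<forall>a. \<bar>a\<bar> < 1 \<longrightarrow> 0 < arccos a \<and> sin (arccos a) \<noteq> 0 \<and> cos (arccos a) = a"
    using arccos_interior sin1 by simp
  note first = eigenvalue_count_branch[OF assms(3) this allI[OF first_band_iff]]
  have "0 < 2 * pi - arccos a" if "\<bar>a\<bar> < 1" for a
    using arccos_interior[OF that] pi_gt_zero by linarith
  then have "\<forall>a. \<bar>a\<bar> < 1 \<longrightarrow>
      0 < 2 * pi - arccos a \<and> sin (2 * pi - arccos a) \<noteq> 0 \<and> cos (2 * pi - arccos a) = a"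
    using sin2 cos2 by blast
  note second = eigenvalue_count_branch[OF assms(3) this allI[OF second_band_iff]]
  have pairing: "\<exists>mu. qg_is_eigenvalue V D mu \<and> 0 < mu \<and> mu < pi\<^sup>2 \<and>
          lam = (2 * pi - sqrt mu)\<^sup>2 \<and> qg_mult V D lam = qg_mult V D mu"
    if lam: "qg_is_eigenvalue V D lam" "pi\<^sup>2 < lam" "lam < (2 * pi)\<^sup>2" for lam
  proof -
    \<comment> \<open>The witness for \<open>mu\<close> is the square of \<open>arccos a\<close>.
      Both frequencies, \<open>arccos a\<close> and its reflection, have cosine \<open>a\<close>, so
      \<open>lam\<close> and \<open>mu\<close> come from the same averaging eigenspace and have
      equal multiplicities.\<close>
    obtain a where a: "\<bar>a\<bar> < 1" and lam_eq: "lam = (2 * pi - arccos a)\<^sup>2"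
      using lam(2,3) second_band_iff[of lam] by auto
    have "qg_is_eigenvalue V D ((arccos a)\<^sup>2)"
      using lam(1) qg_is_eigenvalue_iff[OF sin1[OF a]] qg_is_eigenvalue_iff[OF sin2[OF a]]
      by (simp add: lam_eq cos2[OF a] arccos_interior(3)[OF a])
    moreover have "qg_mult V D lam = qg_mult V D ((arccos a)\<^sup>2)"
      unfolding lam_eq qg_mult_eq_dim[OF sin1[OF a]] qg_mult_eq_dim[OF sin2[OF a]]
        cos2[OF a] arccos_interior(3)[OF a] ..
    moreover have "0 < (arccos a)\<^sup>2 \<and> (arccos a)\<^sup>2 < pi\<^sup>2"
      unfolding first_band_iff using a by (intro exI[of _ a]) simp
    moreover have "sqrt ((arccos a)\<^sup>2) = arccos a"
      using arccos_interior(1)[OF a] by simp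
    ultimately show ?thesis
      using lam_eq by (intro exI[of _ "(arccos a)\<^sup>2"]) metis
  qed
  show ?thesis
    by (intro conjI allI impI first[THEN conjunct1] first[THEN conjunct2] second[THEN conjunct1]
        second[THEN conjunct2] pairing) simp_all
qed

end
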